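(* Let $F$ be a local field of characteristic not $2$, let $(V,B)$ be a finite-dimensional symplectic vector space over $F$, and let $l_1,\ldots,l_n$ ($n\ge 2$) be Lagrangian subspaces of $V$, indexed by $\mathbb Z/n\mathbb Z$. 1. One has $\ker\tilde q_{1,2,\ldots,n}=\operatorname{im}\tilde\partial$, and $\tilde\partial$ is injective. Therefore $$\dim\tilde T_{1,2,\ldots,n}=(n+2)\frac{\dim V}{2}-\sum_{i\in\mathbb Z/n\mathbb Z}\dim (l_i\cap l_{i+1}).$$ 2. $T_{1,2,\ldots,n}$ is (isometric to) the quadratic subquotient of $\tilde T_{1,2,\ldots,n}$ by the image of $V^*\subset\tilde K_{1,2,\ldots,n}$. Therefore $T_{1,2,\ldots,n}$ and $\tilde T_{1,2,\ldots,n}$ have the same class in the Witt group $W(F)$.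
   Context: A quadratic space is a finite-dimensional $F$-vector space with a non-degenerate symmetric bilinear form; $W(F)$ is the Witt group of such spaces. If $T$ is a quadratic space and $I\subset T$ an isotropic subspace, the quadratic subquotient of $T$ by $I$ is $I^\perp/I$ with the induced form. The space $T_{1,\ldots,n}$: $K_{1,\ldots,n}=\{w\in\bigoplus_{i\in\mathbb Z/n\mathbb Z} l_i:\sum_i w_i=0\}$. For $w\in K_{1,\ldots,n}$ an anti-derivative is a family $\hat w=(\hat w_{\{i,i+1\}})_{i\in\mathbb Z/n\mathbb Z}$ of elements of $V$ (one for each edge $\{i,i+1\}$, i.e. for each $i$) with $\hat w_{\{i,i+1\}}-\hat w_{\{i-1,i\}}=w_i$; it exists and is unique up to a constant vector. The symmetric form $q_{1,\ldots,n}(v,w)=\sum_iB(v_i,\hat w_{\{i,i+1\}})$ is independent of the choice of $\hat w$, and $T_{1,\ldots,n}=K_{1,\ldots,n}/\ker q_{1,\ldots,n}$ with the induced non-degenerate form. The space $\tilde T_{1,\ldots,n}$: on $\tilde K_{1,\ldots,n}=V^*\oplus\bigoplus_{i\in\mathbb Z/n\mathbb Z}l_i$ let $\tilde q_{1,\ldots,n}$ be the symmetric bilinear form determined by $$\tilde q_{1,\ldots,n}(v\oplus a,v\oplus a)=2\sum_{i\in\mathbb Z/n\mathbb Z}\langle v,a_i\rangle+\sum_{n\ge i\ge j\ge1}B(a_i,a_j),$$ and let $\tilde T_{1,\ldots,n}=\tilde K_{1,\ldots,n}/\ker\tilde q_{1,\ldots,n}$ with the induced non-degenerate form. The map $\tilde\partial=(-\Phi_{-1},\partial):\bigoplus_{\{i,i+1\}}l_i\cap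 l_{i+1}\to V^*\oplus\bigoplus_il_i=\tilde K_{1,\ldots,n}$ (sum over the $n$ edges, one for each $i\in\mathbb Z/n\mathbb Z$) has components $\langle\Phi_{-1}(a),v\rangle=B(a_{\{n,1\}},v)$ for $v\in V$, and $(\partial a)_i=a_{\{i,i+1\}}-a_{\{i-1,i\}}$. *)

theory Defs
  imports
    "HOL-Analysis.Abstract_Topological_Spaces"
    "HOL-Algebra.AbelCoset"
    "HOL-Library.Function_Algebras"
    "HOL-Library.Product_Plus"
    "Jordan_Normal_Form.VS_Connect"
begin

section \<open>Local fields\<close>

text \<open>A local field is a non-discrete locally compact Hausdorff topological field; this includes the
  archimedean ones.\<close>

definition local_field :: "'f::field topology \<Rightarrow> bool" where
  "local_field X \<longleftrightarrow>
     topspace X = UNIV \<and> Hausdorff_space X \<and> locally_compact_space X \<and>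
     X \<noteq> discrete_topology UNIV \<and>
     continuous_map (prod_topology X X) X (\<lambda>(x, y). x + y) \<and>
     continuous_map X X uminus \<and>
     continuous_map (prod_topology X X) X (\<lambda>(x, y). x * y) \<and>
     continuous_map (subtopology X (- {0})) X inverse"


section \<open>Spaces with a bilinear form and the Witt group\<close>

text \<open>The spaces below are built by passing to subspaces and quotients, so they are represented as
  carrier-based modules. Scalars are taken from a type of class \<open>field\<close>, turned into a ring record by
  \<open>class_ring\<close>. The multiplicative fields that a module record inherits from ring records have no
  meaning.\<close>

record ('f, 'a) form_space = "('f, 'a) module" +
  form :: "'a \<Rightarrow> 'a \<Rightarrow> 'f"

definition symmetric_bilinear_on :: "('f::field, 'a) form_space \<Rightarrow> bool" where
  "symmetric_bilinear_on M \<longleftrightarrow>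
     (\<forall>x\<in>carrier M. \<forall>y\<in>carrier M. form M x y = form M y x) \<and>
     (\<forall>x\<in>carrier M. \<forall>y\<in>carrier M. \<forall>z\<in>carrier M.
        form M (x \<oplus>\<^bsub>M\<^esub> y) z = form M x z + form M y z) \<and>
     (\<forall>c. \<forall>x\<in>carrier M. \<forall>y\<in>carrier M. form M (c \<odot>\<^bsub>M\<^esub> x) y = c * form M x y)"

definition orthogonal :: "('f::field, 'a) form_space \<Rightarrow> 'a set \<Rightarrow> 'a set" where
  "orthogonal M I = {x \<in> carrier M. \<forall>y\<in>I. form M x y = 0}"

abbreviation form_kernel :: "('f::field, 'a) form_space \<Rightarrow> 'a set" where
  "form_kernel M \<equiv> orthogonal M (carrier M)"

definition quadratic_space :: "('f::field, 'a) form_space \<Rightarrow> bool" where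
  "quadratic_space M \<longleftrightarrow>
     vectorspace class_ring M \<and> vectorspace.fin_dim class_ring M \<and>
     symmetric_bilinear_on M \<and> form_kernel M = {\<zero>\<^bsub>M\<^esub>}"

text \<open>The quotient by a subspace \<open>N\<close> contained in the kernel of the form. Elements are cosets, and the
  induced form is evaluated on arbitrary representatives.\<close>

definition quotient_space :: "('f::field, 'a) form_space \<Rightarrow> 'a set \<Rightarrow> ('f, 'a set) form_space" where
  "quotient_space M N =
     \<lparr>carrier = a_rcosets\<^bsub>M\<^esub> N,
      mult = (\<lambda>_ _. N), one = N, zero = N,
      add = (\<lambda>X Y. X <+>\<^bsub>M\<^esub> Y),
      smult = (\<lambda>c X. \<Union>x\<in>X. N +>\<^bsub>M\<^esub> (c \<odot>\<^bsub>M\<^esub> x)),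
      form = (\<lambda>X Y. form M (SOME x. x \<in> X) (SOME y. y \<in> Y))\<rparr>"

definition isotropic_subspace :: "('f::field, 'a) form_space \<Rightarrow> 'a set \<Rightarrow> bool" where
  "isotropic_subspace T I \<longleftrightarrow> subspace class_ring I T \<and> (\<forall>x\<in>I. \<forall>y\<in>I. form T x y = 0)"

definition quadratic_subquotient ::
    "('f::field, 'a) form_space \<Rightarrow> 'a set \<Rightarrow> ('f, 'a set) form_space" where
  "quadratic_subquotient T I = quotient_space (T\<lparr>carrier := orthogonal T I\<rparr>) I"

definition isometric :: "('f::field, 'a) form_space \<Rightarrow> ('f, 'b) form_space \<Rightarrow> bool" where
  "isometric S T \<longleftrightarrow>
     (\<exists>f. linear_map class_ring S T f \<and> bij_betw f (carrier S) (carrier T) \<and>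
          (\<forall>x\<in>carrier S. \<forall>y\<in>carrier S. form T (f x) (f y) = form S x y))"

definition orthogonal_sum ::
    "('f::field, 'a) form_space \<Rightarrow> ('f, 'b) form_space \<Rightarrow> ('f, 'a \<times> 'b) form_space" where
  "orthogonal_sum S T =
     module.extend (direct_sum S T)
       (form_space.fields (\<lambda>x y. form S (fst x) (fst y) + form T (snd x) (snd y)))"

definition space_on ::
    "('f::field \<Rightarrow> 'a \<Rightarrow> 'a) \<Rightarrow> 'a::ab_group_add set \<Rightarrow> ('a \<Rightarrow> 'a \<Rightarrow> 'f) \<Rightarrow> ('f, 'a) form_space" where
  "space_on scl U q =
     \<lparr>carrier = U, mult = (\<lambda>_ _. 0), one = 0, zero = 0, add = (+), smult = scl, form = q\<rparr>"

text \<open>The orthogonal sum of \<open>m\<close> hyperbolic planes, on \<open>F\<^sup>m \<oplus> F\<^sup>m\<close>; vectors in \<open>F\<^sup>m\<close> are functions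
  vanishing outside \<open>{..<m}\<close>.\<close>

definition hyperbolic_space :: "nat \<Rightarrow> ('f::field, (nat \<Rightarrow> 'f) \<times> (nat \<Rightarrow> 'f)) form_space" where
  "hyperbolic_space m =
     space_on (\<lambda>c (x, y). (\<lambda>i. c * x i, \<lambda>i. c * y i))
       ({x. \<forall>i\<ge>m. x i = 0} \<times> {y. \<forall>i\<ge>m. y i = 0})
       (\<lambda>(x, y) (x', y'). \<Sum>i<m. x i * y' i + y i * x' i)"

definition witt_equivalent :: "('f::field, 'a) form_space \<Rightarrow> ('f, 'b) form_space \<Rightarrow> bool" where
  "witt_equivalent S T \<longleftrightarrow>
     (\<exists>m k. isometric (orthogonal_sum S (hyperbolic_space m))
                      (orthogonal_sum T (hyperbolic_space k)))"

text \<open>Quadratic spaces over \<open>'f\<close> live in different types. The Witt class of any of them is represented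
  by the quadratic spaces inside \<open>nat \<Rightarrow> 'f\<close> that are Witt equivalent to it; since every
  finite-dimensional space has an isometric copy there, this loses nothing.\<close>

definition witt_class :: "('f::field, 'a) form_space \<Rightarrow> ('f, nat \<Rightarrow> 'f) form_space set" where
  "witt_class T = {S. quadratic_space S \<and> witt_equivalent T S}"

definition witt_group :: "('f::field, nat \<Rightarrow> 'f) form_space set monoid" where
  "witt_group =
     \<lparr>carrier = witt_class ` {S. quadratic_space (S :: ('f, nat \<Rightarrow> 'f) form_space)},
      mult = (\<lambda>X Y. \<Union>S\<in>X. \<Union>T\<in>Y. witt_class (orthogonal_sum S T)),
      one = witt_class (hyperbolic_space 0 :: ('f, (nat \<Rightarrow> 'f) \<times> (nat \<Rightarrow> 'f)) form_space)\<rparr>"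


section \<open>Symplectic spaces and Lagrangians\<close>

definition symplectic_form :: "('f::field \<Rightarrow> 'v \<Rightarrow> 'v) \<Rightarrow> ('v::ab_group_add \<Rightarrow> 'v \<Rightarrow> 'f) \<Rightarrow> bool" where
  "symplectic_form scl B \<longleftrightarrow>
     (\<forall>v. Vector_Spaces.linear scl (*) (\<lambda>u. B u v)) \<and>
     (\<forall>v. Vector_Spaces.linear scl (*) (B v)) \<and>
     (\<forall>v. B v v = 0) \<and>
     (\<forall>v. (\<forall>w. B v w = 0) \<longrightarrow> v = 0)"

definition lagrangian ::
    "('f::field \<Rightarrow> 'v \<Rightarrow> 'v) \<Rightarrow> ('v::ab_group_add \<Rightarrow> 'v \<Rightarrow> 'f) \<Rightarrow> 'v set \<Rightarrow> bool" where
  "lagrangian scl B L \<longleftrightarrow> module.subspace scl L \<and> L = {v. \<forall>w\<in>L. B v w = 0}"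

text \<open>The set \<open>{1..n}\<close> represents \<open>\<int>/n\<int>\<close>, with \<open>cyc_succ n\<close> and \<open>cyc_pred n\<close> adding and subtracting
  one. A family indexed by the edges \<open>{i, i+1}\<close> is indexed by \<open>i\<close>; in particular \<open>n\<close> stands for the
  edge \<open>{n, 1}\<close>, and for \<open>n = 2\<close> the edges \<open>{1, 2}\<close> and \<open>{2, 1}\<close> are distinct.\<close>

definition cyc_succ :: "nat \<Rightarrow> nat \<Rightarrow> nat" where
  "cyc_succ n i = (if i = n then 1 else i + 1)"

definition cyc_pred :: "nat \<Rightarrow> nat \<Rightarrow> nat" where
  "cyc_pred n i = (if i = 1 then n else i - 1)"

definition family_sum :: "nat \<Rightarrow> (nat \<Rightarrow> 'v::zero set) \<Rightarrow> (nat \<Rightarrow> 'v) set" where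
  "family_sum n l = {a. (\<forall>i\<in>{1..n}. a i \<in> l i) \<and> (\<forall>i. i \<notin> {1..n} \<longrightarrow> a i = 0)}"


section \<open>The space \<open>T\<close>\<close>

definition K_set :: "nat \<Rightarrow> (nat \<Rightarrow> 'v::ab_group_add set) \<Rightarrow> (nat \<Rightarrow> 'v) set" where
  "K_set n l = {w \<in> family_sum n l. (\<Sum>i=1..n. w i) = 0}"

definition anti_derivative :: "nat \<Rightarrow> (nat \<Rightarrow> 'v::ab_group_add) \<Rightarrow> (nat \<Rightarrow> 'v) \<Rightarrow> bool" where
  "anti_derivative n w h \<longleftrightarrow> (\<forall>i\<in>{1..n}. h i - h (cyc_pred n i) = w i)"

definition q_form ::
    "('v::ab_group_add \<Rightarrow> 'v \<Rightarrow> 'f::field) \<Rightarrow> nat \<Rightarrow> (nat \<Rightarrow> 'v) \<Rightarrow> (nat \<Rightarrow> 'v) \<Rightarrow> 'f" where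
  "q_form B n v w = (let h = (SOME h. anti_derivative n w h) in \<Sum>i=1..n. B (v i) (h i))"

lemma anti_derivative_exists:
  assumes "n \<ge> 1" "(\<Sum>i=1..n. w i) = 0"
  shows "\<exists>h. anti_derivative n w h"
proof
  show "anti_derivative n w (\<lambda>i. \<Sum>j=1..i. w j)"
    unfolding anti_derivative_def
  proof
    fix i assume "i \<in> {1..n}"
    then obtain k where i: "i = Suc k" by (cases i) auto
    show "(\<Sum>j=1..i. w j) - (\<Sum>j=1..cyc_pred n i. w j) = w i"
      using assms by (cases k) (simp_all add: i cyc_pred_def)
  qed
qed

lemma anti_derivative_unique:
  assumes "anti_derivative n w h" "anti_derivative n w h'"
  shows "\<exists>c. \<forall>i\<in>{1..n}. h i = h' i + c"
proof -
  have diff: "h i - h' i = h (cyc_pred n i) - h' (cyc_pred n i)" if "i \<in> {1..n}" for i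
  proof -
    have "h i - h (cyc_pred n i) = h' i - h' (cyc_pred n i)"
      using assms that by (simp add: anti_derivative_def)
    then show ?thesis by (simp add: algebra_simps)
  qed
  have "h i - h' i = h 1 - h' 1" if "i \<ge> 1" "i \<le> n" for i
    using that
  proof (induction i rule: dec_induct)
    case (step k)
    then show ?case using diff[of "Suc k"] by (simp add: cyc_pred_def)
  qed simp
  then show ?thesis
    by (intro exI[of _ "h 1 - h' 1"]) (auto simp: algebra_simps)
qed

text \<open>The value of \<open>q_form\<close> does not depend on the anti-derivative.\<close>

lemma q_form_eq:
  assumes B: "symplectic_form scl B" and v: "(\<Sum>i=1..n. v i) = 0"
    and h: "anti_derivative n w h"
  shows "q_form B n v w = (\<Sum>i=1..n. B (v i) (h i))"
proof -
  define h' where "h' = (SOME h. anti_derivative n w h)"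
  have "anti_derivative n w h'"
    unfolding h'_def using h by (rule someI[where P = "anti_derivative n w"])
  from anti_derivative_unique[OF this h] obtain c where
    c: "\<forall>i\<in>{1..n}. h' i = h i + c" ..
  have lin: "Modules.module_hom scl (*) (\<lambda>u. B u x)" "Modules.module_hom scl (*) (B x)" for x
    using B by (simp_all add: symplectic_form_def Vector_Spaces.linear_def)
  have "q_form B n v w = (\<Sum>i=1..n. B (v i) (h' i))"
    by (simp add: q_form_def h'_def Let_def)
  also have "\<dots> = (\<Sum>i=1..n. B (v i) (h i) + B (v i) c)"
    by (rule sum.cong) (auto simp: c Modules.module_hom.add[OF lin(2)])
  also have "\<dots> = (\<Sum>i=1..n. B (v i) (h i)) + B (\<Sum>i=1..n. v i) c"
    by (simp add: sum.distrib Modules.module_hom.sum[OF lin(1)])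
  finally show ?thesis
    using v Modules.module_hom.zero[OF lin(1)] by simp
qed

definition K_space ::
    "('f::field \<Rightarrow> 'v \<Rightarrow> 'v) \<Rightarrow> ('v::ab_group_add \<Rightarrow> 'v \<Rightarrow> 'f) \<Rightarrow> nat \<Rightarrow> (nat \<Rightarrow> 'v set) \<Rightarrow>
      ('f, nat \<Rightarrow> 'v) form_space" where
  "K_space scl B n l = space_on (\<lambda>c a i. scl c (a i)) (K_set n l) (q_form B n)"

definition T_space ::
    "('f::field \<Rightarrow> 'v \<Rightarrow> 'v) \<Rightarrow> ('v::ab_group_add \<Rightarrow> 'v \<Rightarrow> 'f) \<Rightarrow> nat \<Rightarrow> (nat \<Rightarrow> 'v set) \<Rightarrow>
      ('f, (nat \<Rightarrow> 'v) set) form_space" where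
  "T_space scl B n l = quotient_space (K_space scl B n l) (form_kernel (K_space scl B n l))"


section \<open>The space \<open>T\<close> with a tilde\<close>

definition dual :: "('f::field \<Rightarrow> 'v \<Rightarrow> 'v) \<Rightarrow> ('v::ab_group_add \<Rightarrow> 'f) set" where
  "dual scl = {\<phi>. Vector_Spaces.linear scl (*) \<phi>}"

definition Kt_set ::
    "('f::field \<Rightarrow> 'v \<Rightarrow> 'v) \<Rightarrow> nat \<Rightarrow> (nat \<Rightarrow> 'v::ab_group_add set) \<Rightarrow> (('v \<Rightarrow> 'f) \<times> (nat \<Rightarrow> 'v)) set" where
  "Kt_set scl n l = dual scl \<times> family_sum n l"

definition Kt_scale ::
    "('f::field \<Rightarrow> 'v \<Rightarrow> 'v) \<Rightarrow> 'f \<Rightarrow> ('v \<Rightarrow> 'f) \<times> (nat \<Rightarrow> 'v) \<Rightarrow> ('v \<Rightarrow> 'f) \<times> (nat \<Rightarrow> 'v)" where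
  "Kt_scale scl c = (\<lambda>(\<phi>, a). (\<lambda>v. c * \<phi> v, \<lambda>i. scl c (a i)))"

definition qt_diag ::
    "('v::ab_group_add \<Rightarrow> 'v \<Rightarrow> 'f::field) \<Rightarrow> nat \<Rightarrow> ('v \<Rightarrow> 'f) \<times> (nat \<Rightarrow> 'v) \<Rightarrow> 'f" where
  "qt_diag B n = (\<lambda>(\<phi>, a). 2 * (\<Sum>i=1..n. \<phi> (a i)) + (\<Sum>i=1..n. \<Sum>j=1..i. B (a i) (a j)))"

text \<open>The symmetric bilinear form determined by its values \<open>qt_diag\<close> on the diagonal, obtained by
  polarization; see \<open>qt_form_unique\<close> below.\<close>

definition qt_form ::
    "('v::ab_group_add \<Rightarrow> 'v \<Rightarrow> 'f::field) \<Rightarrow> nat \<Rightarrow>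
      ('v \<Rightarrow> 'f) \<times> (nat \<Rightarrow> 'v) \<Rightarrow> ('v \<Rightarrow> 'f) \<times> (nat \<Rightarrow> 'v) \<Rightarrow> 'f" where
  "qt_form B n x y = (qt_diag B n (x + y) - qt_diag B n x - qt_diag B n y) / 2"

lemma two_neq_zero:
  assumes "CHAR('f::field) \<noteq> 2"
  shows "(2::'f) \<noteq> 0"
proof
  assume "(2::'f) = 0"
  then have "CHAR('f) dvd 2"
    using of_nat_eq_0_iff_char_dvd[where 'a='f, of 2] by simp
  then have "CHAR('f) \<in> {1, 2}"
    by (metis insert_iff prime_nat_iff two_is_prime_nat)
  then show False
    using assms by simp
qed

lemma qt_form_eq:
  assumes B: "symplectic_form scl B" and "\<phi> \<in> dual scl" "\<psi> \<in> dual scl"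
    and char: "CHAR('f::field) \<noteq> 2"
  shows "qt_form B n (\<phi>, a) (\<psi>, b :: nat \<Rightarrow> 'v::ab_group_add) =
    (\<Sum>i=1..n. \<phi> (b i)) + (\<Sum>i=1..n. \<psi> (a i)) +
    (\<Sum>i=1..n. \<Sum>j=1..i. B (a i) (b j) + B (b i) (a j)) / (2::'f)"
proof -
  have two: "(2::'f) \<noteq> 0"
    using char by (rule two_neq_zero)
  have lin: "Modules.module_hom scl (*) (\<lambda>u. B u x)" "Modules.module_hom scl (*) (B x)" for x
    using B by (simp_all add: symplectic_form_def Vector_Spaces.linear_def)
  have lin': "Modules.module_hom scl (*) \<phi>" "Modules.module_hom scl (*) \<psi>"
    using assms(2,3) by (simp_all add: dual_def Vector_Spaces.linear_def)
  note add = Modules.module_hom.add[OF lin(1)] Modules.module_hom.add[OF lin(2)]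
    Modules.module_hom.add[OF lin'(1)] Modules.module_hom.add[OF lin'(2)]
  let ?d = "(\<Sum>i=1..n. \<phi> (b i)) + (\<Sum>i=1..n. \<psi> (a i))"
  let ?r = "\<Sum>i=1..n. \<Sum>j=1..i. B (a i) (b j) + B (b i) (a j)"
  have "qt_diag B n ((\<phi>, a) + (\<psi>, b)) - qt_diag B n (\<phi>, a) - qt_diag B n (\<psi>, b) = 2 * ?d + ?r"
    by (simp add: qt_diag_def add sum.distrib distrib_left)
  then show ?thesis
    using two by (simp add: qt_form_def add_divide_distrib)
qed

text \<open>On \<open>Kt_set\<close>, \<open>qt_form\<close> is symmetric bilinear with \<open>qt_diag\<close> on the diagonal, and it is the only
  such form.\<close>

lemma qt_form_properties:
  fixes scl :: "'f::field \<Rightarrow> 'v::ab_group_add \<Rightarrow> 'v"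
  assumes B: "symplectic_form scl B" and char: "CHAR('f) \<noteq> 2"
    and x: "x \<in> Kt_set scl n l" and y: "y \<in> Kt_set scl n l" and z: "z \<in> Kt_set scl n l"
  shows "qt_form B n x x = qt_diag B n x"
    and "qt_form B n x y = qt_form B n y x"
    and "qt_form B n (x + y) z = qt_form B n x z + qt_form B n y z"
    and "qt_form B n (Kt_scale scl c x) y = c * qt_form B n x y"
proof -
  obtain \<phi> a \<psi> b \<omega> d where eqs: "x = (\<phi>, a)" "y = (\<psi>, b)" "z = (\<omega>, d)"
    and mem: "\<phi> \<in> dual scl" "\<psi> \<in> dual scl" "\<omega> \<in> dual scl"
    using x y z by (auto simp: Kt_set_def)
  have two: "(2::'f) \<noteq> 0"
    using char by (rule two_neq_zero)
  have B_hom: "Modules.module_hom scl (*) (\<lambda>u. B u w)" "Modules.module_hom scl (*) (B w)" for w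
    using B by (simp_all add: symplectic_form_def Vector_Spaces.linear_def)
  note B_simps = Modules.module_hom.add[OF B_hom(1)] Modules.module_hom.add[OF B_hom(2)]
    Modules.module_hom.scale[OF B_hom(1)] Modules.module_hom.scale[OF B_hom(2)]
  have dual_hom: "Modules.module_hom scl (*) \<theta>" if "\<theta> \<in> dual scl" for \<theta>
    using that by (simp add: dual_def Vector_Spaces.linear_def)
  note dual_simps =
    Modules.module_hom.add[OF dual_hom] Modules.module_hom.scale[OF dual_hom]
  have dual_closed: "\<phi> + \<psi> \<in> dual scl" "(\<lambda>v. c * \<phi> v) \<in> dual scl"
    using mem by (auto simp: dual_def Vector_Spaces.linear_iff algebra_simps)
  note eq = qt_form_eq[OF B _ _ char]
  show "qt_form B n x x = qt_diag B n x"
    using two by (simp add: eqs eq mem qt_diag_def flip: mult_2 sum_distrib_left)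
  show "qt_form B n x y = qt_form B n y x"
    by (simp add: eqs eq mem add.commute)
  show "qt_form B n (x + y) z = qt_form B n x z + qt_form B n y z"
    by (simp add: eqs eq mem dual_closed B_simps dual_simps sum.distrib add_divide_distrib)
  show "qt_form B n (Kt_scale scl c x) y = c * qt_form B n x y"
    using two
    by (simp add: eqs eq mem dual_closed B_simps dual_simps Kt_scale_def sum.distrib sum_distrib_left
        distrib_left mult.left_commute)
qed

lemma qt_form_unique:
  fixes scl :: "'f::field \<Rightarrow> 'v::ab_group_add \<Rightarrow> 'v"
  assumes B: "symplectic_form scl B" and char: "CHAR('f) \<noteq> 2"
    and l: "\<forall>i\<in>{1..n}. lagrangian scl B (l i)"
    and b: "symmetric_bilinear_on (space_on (Kt_scale scl) (Kt_set scl n l) b)"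
    and diag: "\<And>x. x \<in> Kt_set scl n l \<Longrightarrow> b x x = qt_diag B n x"
    and x: "x \<in> Kt_set scl n l" and y: "y \<in> Kt_set scl n l"
  shows "b x y = qt_form B n x y"
proof -
  have "vector_space scl"
    using B by (auto simp: symplectic_form_def Vector_Spaces.linear_iff)
  then have "Modules.module scl"
    by (simp add: module_iff_vector_space)
  then have "x + y \<in> l i" if "i \<in> {1..n}" "x \<in> l i" "y \<in> l i" for i x y
    using l that by (auto simp: lagrangian_def intro: Modules.module.subspace_add)
  then have closed: "x + y \<in> Kt_set scl n l"
    using x y by (auto simp: Kt_set_def family_sum_def dual_def Vector_Spaces.linear_iff algebra_simps)
  have sym: "b u w = b w u" if "u \<in> Kt_set scl n l" "w \<in> Kt_set scl n l" for u w
    using b that by (simp add: symmetric_bilinear_on_def space_on_def)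
  have add: "b (u + w) z = b u z + b w z"
    if "u \<in> Kt_set scl n l" "w \<in> Kt_set scl n l" "z \<in> Kt_set scl n l" for u w z
    using b that by (simp add: symmetric_bilinear_on_def space_on_def)
  have "b (x + y) (x + y) = b x x + b y y + 2 * b x y"
    using x y closed by (simp add: add sym[of x "x + y"] sym[of y "x + y"] sym[of y x])
  then show ?thesis
    using two_neq_zero[OF char] by (simp add: qt_form_def flip: diag[OF x] diag[OF y] diag[OF closed])
qed

definition Kt_space ::
    "('f::field \<Rightarrow> 'v \<Rightarrow> 'v) \<Rightarrow> ('v::ab_group_add \<Rightarrow> 'v \<Rightarrow> 'f) \<Rightarrow> nat \<Rightarrow> (nat \<Rightarrow> 'v set) \<Rightarrow>
      ('f, ('v \<Rightarrow> 'f) \<times> (nat \<Rightarrow> 'v)) form_space" where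
  "Kt_space scl B n l = space_on (Kt_scale scl) (Kt_set scl n l) (qt_form B n)"

definition Tt_space ::
    "('f::field \<Rightarrow> 'v \<Rightarrow> 'v) \<Rightarrow> ('v::ab_group_add \<Rightarrow> 'v \<Rightarrow> 'f) \<Rightarrow> nat \<Rightarrow> (nat \<Rightarrow> 'v set) \<Rightarrow>
      ('f, (('v \<Rightarrow> 'f) \<times> (nat \<Rightarrow> 'v)) set) form_space" where
  "Tt_space scl B n l =
     quotient_space (Kt_space scl B n l) (form_kernel (Kt_space scl B n l))"

definition dual_image ::
    "('f::field \<Rightarrow> 'v \<Rightarrow> 'v) \<Rightarrow> ('v::ab_group_add \<Rightarrow> 'v \<Rightarrow> 'f) \<Rightarrow> nat \<Rightarrow> (nat \<Rightarrow> 'v set) \<Rightarrow>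
      (('v \<Rightarrow> 'f) \<times> (nat \<Rightarrow> 'v)) set set" where
  "dual_image scl B n l =
     (\<lambda>\<phi>. form_kernel (Kt_space scl B n l) +>\<^bsub>Kt_space scl B n l\<^esub> (\<phi>, 0)) ` dual scl"

definition edge_sum :: "nat \<Rightarrow> (nat \<Rightarrow> 'v::zero set) \<Rightarrow> (nat \<Rightarrow> 'v) set" where
  "edge_sum n l = family_sum n (\<lambda>i. l i \<inter> l (cyc_succ n i))"

definition boundary :: "nat \<Rightarrow> (nat \<Rightarrow> 'v::ab_group_add) \<Rightarrow> (nat \<Rightarrow> 'v)" where
  "boundary n a = (\<lambda>i. if i \<in> {1..n} then a i - a (cyc_pred n i) else 0)"

definition Phi_minus_1 ::
    "('v::ab_group_add \<Rightarrow> 'v \<Rightarrow> 'f::field) \<Rightarrow> nat \<Rightarrow> (nat \<Rightarrow> 'v) \<Rightarrow> ('v \<Rightarrow> 'f)" where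
  "Phi_minus_1 B n a = (\<lambda>v. B (a n) v)"

definition boundary_tilde ::
    "('v::ab_group_add \<Rightarrow> 'v \<Rightarrow> 'f::field) \<Rightarrow> nat \<Rightarrow> (nat \<Rightarrow> 'v) \<Rightarrow> ('v \<Rightarrow> 'f) \<times> (nat \<Rightarrow> 'v)" where
  "boundary_tilde B n a = (- Phi_minus_1 B n a, boundary n a)"

end

theory Submission
  imports Defs
begin

text \<open>
  Write \<open>M\<close> for \<open>V\<^sup>* \<oplus> \<Oplus> l\<^sub>i\<close> with its form. Pairing \<open>(\<phi>, a)\<close> with functionals tests whether the sum of
  the \<open>a\<^sub>i\<close> is zero. When it is, the form of \<open>(\<phi>, a)\<close> and \<open>(\<psi>, b)\<close> becomes the sum of the
  \<open>\<phi>(b\<^sub>i) - B(s\<^sub>i, b\<^sub>i)\<close>, where \<open>s\<^sub>i\<close> are the partial sums of \<open>a\<close> (\<open>qt_form_sum_zero\<close>). Representing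
  \<open>\<phi>\<close> as \<open>B(u, -)\<close>, one sees that \<open>(\<phi>, a)\<close> is in the kernel exactly if all \<open>s\<^sub>i - u\<close> lie in
  \<open>l\<^sub>i\<^sup>\<bottom> = l\<^sub>i\<close>, and these vectors form the unique family in the intersections of neighbouring Lagrangians
  that \<open>boundary_tilde\<close> sends to \<open>(\<phi>, a)\<close> (\<open>form_kernel_Kt\<close>, \<open>boundary_tilde_inj\<close>). The dimension
  formula is then rank-nullity, as a Lagrangian has half the dimension of \<open>V\<close>.

  The subspace \<open>V\<^sup>*\<close> of \<open>M\<close> is isotropic, its orthogonal complement is \<open>P = V\<^sup>* \<oplus> K\<close>, and on \<open>P\<close> the form
  is the one pulled back from \<open>K\<close> (\<open>q_form_eq_qt_form\<close>). So \<open>T\<close> and the subquotient are both obtained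
  from \<open>P\<close> by a form-preserving surjection. For the Witt classes, \<open>V\<^sup>*\<close> is completed to a family of
  hyperbolic pairs, and splitting these off shows that \<open>M\<close> is the image of the orthogonal sum of \<open>P\<close>
  and a hyperbolic space (\<open>hyperbolic_cover\<close>). That sum therefore surjects, preserving forms, onto
  the quotient of \<open>M\<close> by its kernel and onto the sum of \<open>T\<close> and the hyperbolic space.

  Everything is concluded from one principle: two non-degenerate spaces that receive form-preserving
  surjections from the same, possibly degenerate, space are isometric, because both surjections have
  the kernel of the form as their kernel (\<open>isometric_of_nondegenerate_covers\<close>). This avoids choosing
  complements or representatives in the iterated quotients.
\<close>

section \<open>Carrier-based vector spaces and linear maps\<close>

lemma space_on_simps [simp]:
  "carrier (space_on scl U q) = U"
  "\<zero>\<^bsub>space_on scl U q\<^esub> = 0"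
  "x \<oplus>\<^bsub>space_on scl U q\<^esub> y = x + y"
  "c \<odot>\<^bsub>space_on scl U q\<^esub> x = scl c x"
  "form (space_on scl U q) = q"
  "(space_on scl U q)\<lparr>carrier := W\<rparr> = space_on scl W q"
  by (simp_all add: space_on_def)

lemma linear_mapI:
  fixes S :: "('f::field, 'a, 'm) module_scheme" and T :: "('f, 'b, 'n) module_scheme"
  assumes "vectorspace class_ring S" "vectorspace class_ring T"
    and "\<And>x. x \<in> carrier S \<Longrightarrow> f x \<in> carrier T"
    and "\<And>x y. x \<in> carrier S \<Longrightarrow> y \<in> carrier S \<Longrightarrow> f (x \<oplus>\<^bsub>S\<^esub> y) = f x \<oplus>\<^bsub>T\<^esub> f y"
    and "\<And>c x. x \<in> carrier S \<Longrightarrow> f (c \<odot>\<^bsub>S\<^esub> x) = c \<odot>\<^bsub>T\<^esub> f x"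
  shows "linear_map class_ring S T f"
  using assms
  by (simp add: linear_map_def mod_hom_def mod_hom_axioms_def module_hom_def vectorspace_def)

lemma linear_mapD:
  fixes S :: "('f::field, 'a, 'm) module_scheme" and T :: "('f, 'b, 'n) module_scheme"
  assumes "linear_map class_ring S T f"
  shows "vectorspace class_ring S" "vectorspace class_ring T"
    and "\<And>x. x \<in> carrier S \<Longrightarrow> f x \<in> carrier T"
    and "\<And>x y. x \<in> carrier S \<Longrightarrow> y \<in> carrier S \<Longrightarrow> f (x \<oplus>\<^bsub>S\<^esub> y) = f x \<oplus>\<^bsub>T\<^esub> f y"
    and "\<And>c x. x \<in> carrier S \<Longrightarrow> f (c \<odot>\<^bsub>S\<^esub> x) = c \<odot>\<^bsub>T\<^esub> f x"
    and "f \<zero>\<^bsub>S\<^esub> = \<zero>\<^bsub>T\<^esub>"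
  using assms linear_map.T0_is_0[OF assms]
  by (auto simp add: linear_map_def mod_hom_def mod_hom_axioms_def module_hom_def vectorspace_def)

lemma vectorspace_closed:
  fixes M :: "('f::field, 'a, 'm) module_scheme"
  assumes "vectorspace class_ring M"
  shows "\<zero>\<^bsub>M\<^esub> \<in> carrier M"
    and "\<And>x y. x \<in> carrier M \<Longrightarrow> y \<in> carrier M \<Longrightarrow> x \<oplus>\<^bsub>M\<^esub> y \<in> carrier M"
    and "\<And>c x. x \<in> carrier M \<Longrightarrow> c \<odot>\<^bsub>M\<^esub> x \<in> carrier M"
    and "\<And>x. x \<in> carrier M \<Longrightarrow> 0 \<odot>\<^bsub>M\<^esub> x = \<zero>\<^bsub>M\<^esub>"
proof -
  interpret vectorspace class_ring M by fact
  show "\<zero>\<^bsub>M\<^esub> \<in> carrier M"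
    and "\<And>x y. x \<in> carrier M \<Longrightarrow> y \<in> carrier M \<Longrightarrow> x \<oplus>\<^bsub>M\<^esub> y \<in> carrier M"
    and "\<And>c x. x \<in> carrier M \<Longrightarrow> c \<odot>\<^bsub>M\<^esub> x \<in> carrier M"
    by simp_all
  show "\<And>x. x \<in> carrier M \<Longrightarrow> 0 \<odot>\<^bsub>M\<^esub> x = \<zero>\<^bsub>M\<^esub>"
    using smult_l_null by simp
qed

text \<open>The vector space laws pass to the image of any map that is compatible with the operations. This
yields quotients and orthogonal sums without checking the laws again.\<close>

lemma vectorspace_image:
  fixes M :: "('f::field, 'a, 'm) module_scheme" and N :: "('f, 'b, 'n) module_scheme"
  assumes M: "vectorspace class_ring M" and img: "f ` carrier M = carrier N"
    and zero: "f \<zero>\<^bsub>M\<^esub> = \<zero>\<^bsub>N\<^esub>"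
    and add: "\<And>x y. x \<in> carrier M \<Longrightarrow> y \<in> carrier M \<Longrightarrow> f (x \<oplus>\<^bsub>M\<^esub> y) = f x \<oplus>\<^bsub>N\<^esub> f y"
    and smult: "\<And>c x. x \<in> carrier M \<Longrightarrow> f (c \<odot>\<^bsub>M\<^esub> x) = c \<odot>\<^bsub>N\<^esub> f x"
  shows "linear_map class_ring M N f"
proof (rule linear_mapI[OF M _ _ add smult])
  interpret M: vectorspace class_ring M by fact
  have ex: "\<exists>x'\<in>carrier M. x = f x'" if "x \<in> carrier N" for x
    using that img by auto
  show "vectorspace class_ring N"
  proof (rule vs_criteria)
    show "field (class_ring :: 'f ring)" by (rule class_field)
    show "\<zero>\<^bsub>N\<^esub> \<in> carrier N" using img zero by (metis M.zero_closed imageI)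
    show "\<forall>v w. v \<in> carrier N \<and> w \<in> carrier N \<longrightarrow> v \<oplus>\<^bsub>N\<^esub> w \<in> carrier N"
      using img ex by (metis add M.a_closed imageI)
    show "\<forall>v\<in>carrier N. \<exists>neg_v\<in>carrier N. v \<oplus>\<^bsub>N\<^esub> neg_v = \<zero>\<^bsub>N\<^esub>"
    proof
      fix v assume "v \<in> carrier N"
      then obtain x where x: "x \<in> carrier M" "v = f x" using ex by blast
      then have "v \<oplus>\<^bsub>N\<^esub> f (\<ominus>\<^bsub>M\<^esub> x) = \<zero>\<^bsub>N\<^esub>"
        by (simp add: M.r_neg zero flip: add)
      then show "\<exists>neg_v\<in>carrier N. v \<oplus>\<^bsub>N\<^esub> neg_v = \<zero>\<^bsub>N\<^esub>"
        using x img M.a_inv_closed by blast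
    qed
    note simps = M.a_ac M.smult_l_distr[simplified] M.smult_r_distr[simplified]
      M.smult_assoc1[simplified] M.smult_one[simplified]
    show "\<forall>c v. c \<in> carrier class_ring \<and> v \<in> carrier N \<longrightarrow> c \<odot>\<^bsub>N\<^esub> v \<in> carrier N"
      using img ex by (metis smult vectorspace_closed(3)[OF M] imageI)
    show "\<forall>v w. v \<in> carrier N \<and> w \<in> carrier N \<longrightarrow> v \<oplus>\<^bsub>N\<^esub> w = w \<oplus>\<^bsub>N\<^esub> v"
      by (auto dest!: ex simp: simps simp flip: add)
    show "\<forall>v w x. v \<in> carrier N \<and> w \<in> carrier N \<and> x \<in> carrier N \<longrightarrow>
        v \<oplus>\<^bsub>N\<^esub> w \<oplus>\<^bsub>N\<^esub> x = v \<oplus>\<^bsub>N\<^esub> (w \<oplus>\<^bsub>N\<^esub> x)"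
      by (auto dest!: ex simp: simps simp flip: add)
    show "\<forall>v\<in>carrier N. v \<oplus>\<^bsub>N\<^esub> \<zero>\<^bsub>N\<^esub> = v"
      by (auto dest!: ex simp: simps simp flip: add zero)
    show "\<forall>a b v. a \<in> carrier class_ring \<and> b \<in> carrier class_ring \<and> v \<in> carrier N \<longrightarrow>
        (a \<otimes>\<^bsub>class_ring\<^esub> b) \<odot>\<^bsub>N\<^esub> v = a \<odot>\<^bsub>N\<^esub> (b \<odot>\<^bsub>N\<^esub> v)"
      by (auto dest!: ex simp: simps simp flip: smult)
    show "\<forall>v\<in>carrier N. \<one>\<^bsub>class_ring\<^esub> \<odot>\<^bsub>N\<^esub> v = v"
      by (auto dest!: ex simp: simps simp flip: smult)
    show "\<forall>a b v. a \<in> carrier class_ring \<and> b \<in> carrier class_ring \<and> v \<in> carrier N \<longrightarrow>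
        (a \<oplus>\<^bsub>class_ring\<^esub> b) \<odot>\<^bsub>N\<^esub> v = a \<odot>\<^bsub>N\<^esub> v \<oplus>\<^bsub>N\<^esub> b \<odot>\<^bsub>N\<^esub> v"
      by (auto dest!: ex simp: simps simp flip: smult add)
    show "\<forall>a v w. a \<in> carrier class_ring \<and> v \<in> carrier N \<and> w \<in> carrier N \<longrightarrow>
        a \<odot>\<^bsub>N\<^esub> (v \<oplus>\<^bsub>N\<^esub> w) = a \<odot>\<^bsub>N\<^esub> v \<oplus>\<^bsub>N\<^esub> a \<odot>\<^bsub>N\<^esub> w"
      by (auto dest!: ex simp: simps simp flip: smult add)
  qed
qed (use img in auto)

lemma vectorspace_space_on:
  assumes "vector_space scl" "module.subspace scl U"
  shows "vectorspace class_ring (space_on scl U q)"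
proof -
  interpret vector_space scl by fact
  note closed = subspace_0[OF assms(2)] subspace_add[OF assms(2)] subspace_scale[OF assms(2)]
    subspace_neg[OF assms(2)]
  show ?thesis
    by (rule vs_criteria)
      (auto simp: closed class_field algebra_simps intro: bexI[of _ "- x" for x])
qed

lemma vector_space_pointwise:
  assumes "vector_space scl"
  shows "vector_space (\<lambda>c a i. scl c (a i))"
proof -
  interpret vector_space scl by fact
  show ?thesis
    by unfold_locales (auto simp: fun_eq_iff algebra_simps)
qed

lemma vector_space_times: "vector_space ((*) :: 'f::field \<Rightarrow> 'f \<Rightarrow> 'f)"
  by unfold_locales (auto simp: algebra_simps)

section \<open>Form-preserving surjections\<close>

text \<open>Injectivity is left out on purpose: the forms on \<open>K\<close> and \<open>V\<^sup>* \<oplus> \<Oplus> l\<^sub>i\<close> are degenerate, and two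
non-degenerate spaces are compared below through a common degenerate space that surjects onto both.\<close>

definition isometric_cover ::
    "('f::field, 'a) form_space \<Rightarrow> ('f, 'b) form_space \<Rightarrow> ('a \<Rightarrow> 'b) \<Rightarrow> bool" where
  "isometric_cover P S f \<longleftrightarrow>
     linear_map class_ring P S f \<and> f ` carrier P = carrier S \<and>
     (\<forall>x\<in>carrier P. \<forall>y\<in>carrier P. form S (f x) (f y) = form P x y)"

lemma isometric_iff_cover:
  "isometric S T \<longleftrightarrow> (\<exists>f. isometric_cover S T f \<and> inj_on f (carrier S))"
  by (auto simp: isometric_def isometric_cover_def bij_betw_def)

lemma isometric_cover_id:
  "vectorspace class_ring S \<Longrightarrow> isometric_cover S S (\<lambda>x. x)"
  by (auto simp: isometric_cover_def intro: linear_mapI)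

lemma isometric_cover_comp:
  assumes f: "isometric_cover R S f" and g: "isometric_cover S T g"
  shows "isometric_cover R T (\<lambda>x. g (f x))"
proof -
  have lin: "linear_map class_ring R S f" "linear_map class_ring S T g"
    using f g by (auto simp: isometric_cover_def)
  have "linear_map class_ring R T (\<lambda>x. g (f x))"
    by (rule linear_mapI) (simp_all add: linear_mapD[OF lin(1)] linear_mapD[OF lin(2)])
  then show ?thesis
    using f g linear_mapD(3)[OF lin(1)] unfolding isometric_cover_def image_image[symmetric]
    by simp
qed

text \<open>The rule \<open>g x \<mapsto> f x\<close> is a well-defined bijection because the fibres agree, and it is linear and
preserves the forms because \<open>g\<close> and \<open>f\<close> do.\<close>

lemma isometric_of_covers:
  assumes g: "isometric_cover P S g" and f: "isometric_cover P T f"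
    and eq: "\<And>x y. x \<in> carrier P \<Longrightarrow> y \<in> carrier P \<Longrightarrow> g x = g y \<longleftrightarrow> f x = f y"
  shows "isometric S T"
proof -
  define h where "h s = f (SOME x. x \<in> carrier P \<and> g x = s)" for s
  have h: "h (g x) = f x" if "x \<in> carrier P" for x
  proof -
    have "(SOME y. y \<in> carrier P \<and> g y = g x) \<in> carrier P \<and>
        g (SOME y. y \<in> carrier P \<and> g y = g x) = g x"
      by (rule someI[where P = "\<lambda>y. y \<in> carrier P \<and> g y = g x"]) (use that in simp)
    then show ?thesis
      unfolding h_def using eq that by blast
  qed
  have lin: "linear_map class_ring P S g" "linear_map class_ring P T f"
    and S: "carrier S = g ` carrier P" and T: "carrier T = f ` carrier P"
    using f g by (auto simp: isometric_cover_def)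
  note closed = vectorspace_closed[OF linear_mapD(1)[OF lin(1)]]
  have "linear_map class_ring S T h"
    by (rule linear_mapI)
      (auto simp: S T h closed linear_mapD[OF lin(1)] linear_mapD[OF lin(2)]
        simp flip: linear_mapD(4,5)[OF lin(1)])
  moreover have "bij_betw h (carrier S) (carrier T)"
    by (auto simp: bij_betw_def inj_on_def S T h eq image_image cong: image_cong)
  ultimately show ?thesis
    using f g by (auto simp: isometric_def isometric_cover_def S h intro!: exI[of _ h])
qed

lemma isometric_vectorspace:
  assumes "isometric S T"
  shows "vectorspace class_ring S" "vectorspace class_ring T"
  using assms linear_mapD(1,2) by (auto simp: isometric_def)

lemma isometric_refl: "vectorspace class_ring S \<Longrightarrow> isometric S S"
  using isometric_of_covers isometric_cover_id by blast

lemma isometric_sym: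
  assumes "isometric S T" shows "isometric T S"
proof -
  obtain f where f: "isometric_cover S T f" "inj_on f (carrier S)"
    using assms by (auto simp: isometric_iff_cover)
  show ?thesis
    using isometric_of_covers[OF f(1) isometric_cover_id[OF isometric_vectorspace(1)[OF assms]]]
      inj_onD[OF f(2)] by blast
qed

lemma isometric_trans:
  assumes "isometric R S" "isometric S T" shows "isometric R T"
proof -
  obtain f g where f: "isometric_cover R S f" "inj_on f (carrier R)"
    and g: "isometric_cover S T g" "inj_on g (carrier S)"
    using assms by (auto simp: isometric_iff_cover)
  have "f ` carrier R = carrier S" using f by (simp add: isometric_cover_def)
  then have "inj_on (g \<circ> f) (carrier R)" using f g by (simp add: comp_inj_on)
  then show ?thesis
    using isometric_cover_comp[OF f(1) g(1)] by (auto simp: isometric_iff_cover o_def)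
qed

lemma symmetric_bilinear_cover:
  assumes "isometric_cover P S f" "symmetric_bilinear_on P"
  shows "symmetric_bilinear_on S"
proof -
  have lin: "linear_map class_ring P S f"
    and S: "carrier S = f ` carrier P"
    and form: "\<And>x y. x \<in> carrier P \<Longrightarrow> y \<in> carrier P \<Longrightarrow> form S (f x) (f y) = form P x y"
    using assms(1) by (auto simp: isometric_cover_def)
  note closed = vectorspace_closed[OF linear_mapD(1)[OF lin]]
  show ?thesis
    using assms(2)
    by (auto simp: symmetric_bilinear_on_def S form closed simp flip: linear_mapD(4,5)[OF lin])
qed

text \<open>The difference of two vectors with the same values of the form lies in the kernel.\<close>

lemma nondegenerate_separates:
  assumes V: "vectorspace class_ring S" and sym: "symmetric_bilinear_on S"
    and ker: "form_kernel S = {\<zero>\<^bsub>S\<^esub>}"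
    and ab: "a \<in> carrier S" "b \<in> carrier S"
    and eq: "\<And>s. s \<in> carrier S \<Longrightarrow> form S a s = form S b s"
  shows "a = b"
proof -
  interpret vectorspace class_ring S by fact
  let ?m = "(-1) \<odot>\<^bsub>S\<^esub> b"
  have m: "?m \<in> carrier S" using ab by simp
  have "form S (a \<oplus>\<^bsub>S\<^esub> ?m) s = 0" if "s \<in> carrier S" for s
  proof -
    have "form S (a \<oplus>\<^bsub>S\<^esub> ?m) s = form S a s + (-1) * form S b s"
      using sym ab m that unfolding symmetric_bilinear_on_def by metis
    then show ?thesis using eq[OF that] by simp
  qed
  then have "a \<oplus>\<^bsub>S\<^esub> ?m \<in> form_kernel S"
    using ab m by (simp add: orthogonal_def)
  then have am: "a \<oplus>\<^bsub>S\<^esub> ?m = \<zero>\<^bsub>S\<^esub>" using ker by simp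
  have "?m \<oplus>\<^bsub>S\<^esub> b = (-1 + 1) \<odot>\<^bsub>S\<^esub> b"
    using smult_l_distr[of "-1" 1 b] smult_one[OF ab(2)] ab by simp
  also have "\<dots> = \<zero>\<^bsub>S\<^esub>" using smult_l_null ab by simp
  finally have mb: "?m \<oplus>\<^bsub>S\<^esub> b = \<zero>\<^bsub>S\<^esub>" .
  have "a = a \<oplus>\<^bsub>S\<^esub> (?m \<oplus>\<^bsub>S\<^esub> b)" using ab mb by simp
  also have "\<dots> = (a \<oplus>\<^bsub>S\<^esub> ?m) \<oplus>\<^bsub>S\<^esub> b" using ab m by (simp add: a_assoc)
  also have "\<dots> = b" using am ab by simp
  finally show ?thesis .
qed

text \<open>The fibres of a form-preserving surjection onto a non-degenerate space are determined by the form
on the source alone.\<close>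

lemma cover_eq_iff:
  assumes f: "isometric_cover P S f" and sym: "symmetric_bilinear_on P"
    and ker: "form_kernel S = {\<zero>\<^bsub>S\<^esub>}"
    and xy: "x \<in> carrier P" "y \<in> carrier P"
  shows "f x = f y \<longleftrightarrow> (\<forall>z\<in>carrier P. form P x z = form P y z)"
proof
  have form: "\<And>x y. x \<in> carrier P \<Longrightarrow> y \<in> carrier P \<Longrightarrow> form P x y = form S (f x) (f y)"
    and S: "carrier S = f ` carrier P"
    using f by (auto simp: isometric_cover_def)
  then show "\<forall>z\<in>carrier P. form P x z = form P y z" if "f x = f y"
    using that xy by simp
  show "f x = f y" if "\<forall>z\<in>carrier P. form P x z = form P y z"
  proof (rule nondegenerate_separates[OF _ symmetric_bilinear_cover[OF f sym] ker])
    show "vectorspace class_ring S"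
      using f linear_mapD(2) by (auto simp: isometric_cover_def)
  qed (use that xy in \<open>auto simp: S form\<close>)
qed

text \<open>Both targets are the quotient of \<open>P\<close> by its kernel, so they agree.\<close>

lemma isometric_of_nondegenerate_covers:
  assumes "isometric_cover P S g" "isometric_cover P T f" "symmetric_bilinear_on P"
    and "form_kernel S = {\<zero>\<^bsub>S\<^esub>}" "form_kernel T = {\<zero>\<^bsub>T\<^esub>}"
  shows "isometric S T"
  using assms by (intro isometric_of_covers[where P = P and f = f and g = g]) (simp_all add: cover_eq_iff)

lemma form_kernel_cover:
  assumes "isometric_cover P S f"
  shows "form_kernel S = f ` form_kernel P"
proof -
  have S: "carrier S = f ` carrier P"
    and "\<And>x y. x \<in> carrier P \<Longrightarrow> y \<in> carrier P \<Longrightarrow> form S (f x) (f y) = form P x y"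
    using assms by (auto simp: isometric_cover_def)
  then show ?thesis by (auto simp: orthogonal_def image_iff)
qed

lemma quadratic_space_of_cover:
  assumes f: "isometric_cover P S f" and sym: "symmetric_bilinear_on P"
    and fin_dim_P: "vectorspace.fin_dim class_ring P"
    and ker: "\<And>x. x \<in> form_kernel P \<Longrightarrow> f x = \<zero>\<^bsub>S\<^esub>"
  shows "quadratic_space S"
proof -
  interpret linear_map class_ring P S f using f by (simp add: isometric_cover_def)
  have "f ` carrier P = carrier S" using f by (simp add: isometric_cover_def)
  then have fd: "W.fin_dim" using rank_nullity_main(2)[OF fin_dim_P] by simp
  have "\<zero>\<^bsub>S\<^esub> \<in> f ` form_kernel P"
  proof
    have "form P \<zero>\<^bsub>P\<^esub> y = 0" if "y \<in> carrier P" for y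
    proof -
      have "form P (0 \<odot>\<^bsub>P\<^esub> \<zero>\<^bsub>P\<^esub>) y = 0 * form P \<zero>\<^bsub>P\<^esub> y"
        using sym that unfolding symmetric_bilinear_on_def by blast
      then show ?thesis
        by (simp add: vectorspace_closed[OF V.vectorspace_axioms])
    qed
    then show "\<zero>\<^bsub>P\<^esub> \<in> form_kernel P" by (simp add: orthogonal_def)
  qed simp
  then have "form_kernel S = {\<zero>\<^bsub>S\<^esub>}"
    using form_kernel_cover[OF f] ker by auto
  then show ?thesis
    using symmetric_bilinear_cover[OF f sym] fd W.vectorspace_axioms
    by (simp add: quadratic_space_def)
qed

section \<open>Quotients by subspaces of the kernel\<close>

lemma coset_facts:
  fixes M :: "('f::field, 'a, 'm) module_scheme"
  assumes V: "vectorspace class_ring M" and N: "VectorSpace.subspace class_ring N M"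
  shows "x \<in> carrier M \<Longrightarrow> y \<in> carrier M \<Longrightarrow> (N +>\<^bsub>M\<^esub> x) <+>\<^bsub>M\<^esub> (N +>\<^bsub>M\<^esub> y) = N +>\<^bsub>M\<^esub> (x \<oplus>\<^bsub>M\<^esub> y)"
    and "x \<in> carrier M \<Longrightarrow> x' \<in> N +>\<^bsub>M\<^esub> x \<Longrightarrow> N +>\<^bsub>M\<^esub> x' = N +>\<^bsub>M\<^esub> x"
    and "x \<in> carrier M \<Longrightarrow> x \<in> N +>\<^bsub>M\<^esub> x"
    and "x \<in> N \<Longrightarrow> N +>\<^bsub>M\<^esub> x = N"
    and "N +>\<^bsub>M\<^esub> \<zero>\<^bsub>M\<^esub> = N"
proof -
  interpret M: vectorspace class_ring M by fact
  interpret N: submodule class_ring N M using N by (rule M.is_module)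
  have neg: "\<ominus>\<^bsub>M\<^esub> x \<in> N" if "x \<in> N" for x
  proof -
    have "(-1) \<odot>\<^bsub>M\<^esub> x = \<ominus>\<^bsub>M\<^esub> x"
      using M.smult_minus_1[OF subsetD[OF N.subset that]] by (simp only: class_ring_simps)
    then show ?thesis using N.smult_closed[OF _ that, of "-1"] by simp
  qed
  have sg: "subgroup N (add_monoid M)"
  proof (rule M.add.subgroupI)
    show "N \<noteq> {}" using N.zero_closed by blast
  qed (use N.subset neg in auto)
  interpret abelian_subgroup N M
    using sg by (intro abelian_subgroupI3 additive_subgroup.intro M.abelian_group_axioms)
  show "x \<in> carrier M \<Longrightarrow> y \<in> carrier M \<Longrightarrow> (N +>\<^bsub>M\<^esub> x) <+>\<^bsub>M\<^esub> (N +>\<^bsub>M\<^esub> y) = N +>\<^bsub>M\<^esub> (x \<oplus>\<^bsub>M\<^esub> y)"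
    by (rule a_rcos_sum)
  show "x \<in> carrier M \<Longrightarrow> x' \<in> N +>\<^bsub>M\<^esub> x \<Longrightarrow> N +>\<^bsub>M\<^esub> x' = N +>\<^bsub>M\<^esub> x"
    using M.a_repr_independence[OF _ _ sg] by metis
  show "x \<in> carrier M \<Longrightarrow> x \<in> N +>\<^bsub>M\<^esub> x"
    by (rule a_rcos_self)
  show *: "N +>\<^bsub>M\<^esub> x = N" if "x \<in> N" for x
    using that by (rule a_rcos_const)
  show "N +>\<^bsub>M\<^esub> \<zero>\<^bsub>M\<^esub> = N" by (rule *) simp
qed

lemma quotient_space_simps [simp]:
  "carrier (quotient_space M N) = (\<lambda>x. N +>\<^bsub>M\<^esub> x) ` carrier M"
  "\<zero>\<^bsub>quotient_space M N\<^esub> = N"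
  "X \<oplus>\<^bsub>quotient_space M N\<^esub> Y = X <+>\<^bsub>M\<^esub> Y"
  "c \<odot>\<^bsub>quotient_space M N\<^esub> X = (\<Union>x\<in>X. N +>\<^bsub>M\<^esub> (c \<odot>\<^bsub>M\<^esub> x))"
  "form (quotient_space M N) X Y = form M (SOME x. x \<in> X) (SOME y. y \<in> Y)"
  by (auto simp: quotient_space_def A_RCOSETS_def')

text \<open>Neither the scalar action nor the form on cosets depends on representatives: \<open>N\<close> is a
subspace, and it lies in the kernel of the form. The quotient thus inherits the vector space laws and the properties of the form
through the projection.\<close>

lemma quotient_cover:
  assumes V: "vectorspace class_ring M" and N: "VectorSpace.subspace class_ring N M"
    and sym: "symmetric_bilinear_on M" and ker: "N \<subseteq> form_kernel M"
  shows "isometric_cover M (quotient_space M N) (\<lambda>x. N +>\<^bsub>M\<^esub> x)"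
proof -
  interpret M: vectorspace class_ring M by fact
  interpret N: submodule class_ring N M using N by (rule M.is_module)
  note facts = coset_facts[OF V N]
  have mem: "\<exists>h\<in>N. x' = h \<oplus>\<^bsub>M\<^esub> x" if "x' \<in> N +>\<^bsub>M\<^esub> x" for x' x
    using that by (auto simp: a_r_coset_def')
  have smult: "(\<Union>x'\<in>N +>\<^bsub>M\<^esub> x. N +>\<^bsub>M\<^esub> (c \<odot>\<^bsub>M\<^esub> x')) = N +>\<^bsub>M\<^esub> (c \<odot>\<^bsub>M\<^esub> x)"
    if x: "x \<in> carrier M" for c x
  proof -
    have "N +>\<^bsub>M\<^esub> (c \<odot>\<^bsub>M\<^esub> x') = N +>\<^bsub>M\<^esub> (c \<odot>\<^bsub>M\<^esub> x)" if x': "x' \<in> N +>\<^bsub>M\<^esub> x" for x'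
    proof (rule facts(2))
      show "c \<odot>\<^bsub>M\<^esub> x \<in> carrier M" using x by simp
      obtain h where h: "h \<in> N" "x' = h \<oplus>\<^bsub>M\<^esub> x" using mem[OF x'] by blast
      have eq: "c \<odot>\<^bsub>M\<^esub> x' = (c \<odot>\<^bsub>M\<^esub> h) \<oplus>\<^bsub>M\<^esub> (c \<odot>\<^bsub>M\<^esub> x)"
        using x subsetD[OF N.subset h(1)] h(2) by (simp add: M.smult_r_distr)
      have "c \<odot>\<^bsub>M\<^esub> h \<in> N" using N.smult_closed[OF _ h(1), of c] by simp
      then show "c \<odot>\<^bsub>M\<^esub> x' \<in> N +>\<^bsub>M\<^esub> (c \<odot>\<^bsub>M\<^esub> x)"
        unfolding eq a_r_coset_def' by blast
    qed
    then show ?thesis using facts(3)[OF x] by (intro SUP_eq_const) blast+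
  qed
  have form: "form M x' y' = form M x y"
    if xy: "x \<in> carrier M" "y \<in> carrier M" and x'y': "x' \<in> N +>\<^bsub>M\<^esub> x" "y' \<in> N +>\<^bsub>M\<^esub> y" for x y x' y'
  proof -
    obtain h k where hk: "h \<in> N" "x' = h \<oplus>\<^bsub>M\<^esub> x" "k \<in> N" "y' = k \<oplus>\<^bsub>M\<^esub> y"
      using mem[OF x'y'(1)] mem[OF x'y'(2)] by blast
    have c: "h \<in> carrier M" "k \<in> carrier M" using hk N.subset by auto
    have add: "form M (u \<oplus>\<^bsub>M\<^esub> v) w = form M u w + form M v w"
      and comm: "form M u v = form M v u"
      if "u \<in> carrier M" "v \<in> carrier M" "w \<in> carrier M" for u v w
      using sym that unfolding symmetric_bilinear_on_def by blast+
    have zero: "form M h w = 0" "form M k w = 0" if "w \<in> carrier M" for w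
      using ker hk that by (auto simp: orthogonal_def)
    have y': "y' \<in> carrier M" using hk xy c by simp
    have "form M x' y' = form M x y'"
      using hk(2) c xy y' add zero by simp
    also have "\<dots> = form M y' x" using comm xy y' by simp
    also have "\<dots> = form M y x" using hk(4) c xy add zero by simp
    also have "\<dots> = form M x y" using comm xy by simp
    finally show ?thesis .
  qed
  have some: "(SOME x'. x' \<in> N +>\<^bsub>M\<^esub> x) \<in> N +>\<^bsub>M\<^esub> x" if "x \<in> carrier M" for x
    using facts(3)[OF that] by (rule someI)
  have lin: "linear_map class_ring M (quotient_space M N) (\<lambda>x. N +>\<^bsub>M\<^esub> x)"
  proof (rule vectorspace_image[OF V])
    show "N +>\<^bsub>M\<^esub> \<zero>\<^bsub>M\<^esub> = \<zero>\<^bsub>quotient_space M N\<^esub>"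
      unfolding quotient_space_simps by (rule facts(5))
    fix x assume x: "x \<in> carrier M"
    show "N +>\<^bsub>M\<^esub> (c \<odot>\<^bsub>M\<^esub> x) = c \<odot>\<^bsub>quotient_space M N\<^esub> (N +>\<^bsub>M\<^esub> x)" for c
      unfolding quotient_space_simps by (rule smult[OF x, symmetric])
    show "N +>\<^bsub>M\<^esub> (x \<oplus>\<^bsub>M\<^esub> y) = (N +>\<^bsub>M\<^esub> x) \<oplus>\<^bsub>quotient_space M N\<^esub> (N +>\<^bsub>M\<^esub> y)"
      if "y \<in> carrier M" for y
      unfolding quotient_space_simps by (rule facts(1)[OF x that, symmetric])
  qed (simp only: quotient_space_simps)
  have "form (quotient_space M N) (N +>\<^bsub>M\<^esub> x) (N +>\<^bsub>M\<^esub> y) = form M x y"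
    if "x \<in> carrier M" "y \<in> carrier M" for x y
    unfolding quotient_space_simps by (rule form[OF that some[OF that(1)] some[OF that(2)]])
  then show ?thesis
    using lin unfolding isometric_cover_def quotient_space_simps by blast
qed

lemma orthogonal_is_subspace:
  assumes V: "vectorspace class_ring M" and sym: "symmetric_bilinear_on M"
    and I: "I \<subseteq> carrier M"
  shows "VectorSpace.subspace class_ring (orthogonal M I) M"
proof -
  interpret M: vectorspace class_ring M by fact
  have add: "form M (u \<oplus>\<^bsub>M\<^esub> v) w = form M u w + form M v w"
    and scale: "form M (c \<odot>\<^bsub>M\<^esub> u) w = c * form M u w"
    if "u \<in> carrier M" "v \<in> carrier M" "w \<in> carrier M" for u v w c
    using sym that unfolding symmetric_bilinear_on_def by blast+
  have zero: "form M \<zero>\<^bsub>M\<^esub> w = 0" if "w \<in> carrier M" for w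
    using scale[of "\<zero>\<^bsub>M\<^esub>" "\<zero>\<^bsub>M\<^esub>" w 0] that vectorspace_closed[OF V] by simp
  have "submodule class_ring (orthogonal M I) M"
    using I by unfold_locales (auto simp: orthogonal_def zero add scale subset_iff)
  then show ?thesis using V by (simp add: VectorSpace.subspace_def)
qed

lemma quadratic_space_quotient_kernel:
  assumes V: "vectorspace class_ring M" and sym: "symmetric_bilinear_on M"
    and fin: "vectorspace.fin_dim class_ring M"
  shows "isometric_cover M (quotient_space M (form_kernel M)) (\<lambda>x. form_kernel M +>\<^bsub>M\<^esub> x)"
    and "quadratic_space (quotient_space M (form_kernel M))"
proof -
  note sub = orthogonal_is_subspace[OF V sym order.refl]
  show cover: "isometric_cover M (quotient_space M (form_kernel M)) (\<lambda>x. form_kernel M +>\<^bsub>M\<^esub> x)"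
    by (rule quotient_cover[OF V sub sym order.refl])
  show "quadratic_space (quotient_space M (form_kernel M))"
    by (rule quadratic_space_of_cover[OF cover sym fin])
      (simp add: coset_facts[OF V sub] quotient_space_def)
qed

section \<open>Orthogonal sums\<close>

lemma orthogonal_sum_simps [simp]:
  "carrier (orthogonal_sum S T) = carrier S \<times> carrier T"
  "\<zero>\<^bsub>orthogonal_sum S T\<^esub> = (\<zero>\<^bsub>S\<^esub>, \<zero>\<^bsub>T\<^esub>)"
  "x \<oplus>\<^bsub>orthogonal_sum S T\<^esub> y = (fst x \<oplus>\<^bsub>S\<^esub> fst y, snd x \<oplus>\<^bsub>T\<^esub> snd y)"
  "c \<odot>\<^bsub>orthogonal_sum S T\<^esub> x = (c \<odot>\<^bsub>S\<^esub> fst x, c \<odot>\<^bsub>T\<^esub> snd x)"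
  "form (orthogonal_sum S T) x y = form S (fst x) (fst y) + form T (snd x) (snd y)"
  by (simp_all add: orthogonal_sum_def direct_sum_def module.defs form_space.defs)

lemma vectorspace_orthogonal_sum:
  assumes "vectorspace class_ring S" "vectorspace class_ring T"
  shows "vectorspace class_ring (orthogonal_sum S T)"
  using direct_sum_is_vs[OF assms]
  by (rule linear_mapD(2)[OF vectorspace_image[where f = "\<lambda>x. x"]])
    (simp_all add: direct_sum_def)

lemma symmetric_bilinear_orthogonal_sum:
  assumes "symmetric_bilinear_on S" "symmetric_bilinear_on T"
  shows "symmetric_bilinear_on (orthogonal_sum S T)"
  using assms by (auto simp: symmetric_bilinear_on_def distrib_left)

lemma form_zero_right:
  assumes V: "vectorspace class_ring S" and sym: "symmetric_bilinear_on S" and x: "x \<in> carrier S"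
  shows "form S x \<zero>\<^bsub>S\<^esub> = 0"
proof -
  have "form S (0 \<odot>\<^bsub>S\<^esub> \<zero>\<^bsub>S\<^esub>) x = 0 * form S \<zero>\<^bsub>S\<^esub> x" "form S x \<zero>\<^bsub>S\<^esub> = form S \<zero>\<^bsub>S\<^esub> x"
    using sym x vectorspace_closed(1)[OF V] unfolding symmetric_bilinear_on_def by blast+
  then show ?thesis by (simp add: vectorspace_closed[OF V])
qed

lemma form_kernel_orthogonal_sum:
  assumes "vectorspace class_ring S" "vectorspace class_ring T"
    and "symmetric_bilinear_on S" "symmetric_bilinear_on T"
  shows "form_kernel (orthogonal_sum S T) = form_kernel S \<times> form_kernel T"
proof -
  note c = vectorspace_closed(1)[OF assms(1)] vectorspace_closed(1)[OF assms(2)]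
  show ?thesis
    using c form_zero_right[OF assms(1,3)] form_zero_right[OF assms(2,4)]
    by (force simp: orthogonal_def)
qed

lemma isometric_cover_sum:
  assumes f: "isometric_cover S S' f" and g: "isometric_cover T T' g"
  shows "isometric_cover (orthogonal_sum S T) (orthogonal_sum S' T') (map_prod f g)"
proof -
  have lin: "linear_map class_ring S S' f" "linear_map class_ring T T' g"
    and S: "carrier S' = f ` carrier S" "carrier T' = g ` carrier T"
    and form: "\<And>x y. x \<in> carrier S \<Longrightarrow> y \<in> carrier S \<Longrightarrow> form S' (f x) (f y) = form S x y"
      "\<And>x y. x \<in> carrier T \<Longrightarrow> y \<in> carrier T \<Longrightarrow> form T' (g x) (g y) = form T x y"
    using f g by (auto simp: isometric_cover_def)
  have "linear_map class_ring (orthogonal_sum S T) (orthogonal_sum S' T') (map_prod f g)"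
    by (rule linear_mapI)
      (auto simp: vectorspace_orthogonal_sum linear_mapD[OF lin(1)] linear_mapD[OF lin(2)])
  moreover have "map_prod f g ` (carrier S \<times> carrier T) = carrier S' \<times> carrier T'"
    using S by auto
  ultimately show ?thesis by (auto simp: isometric_cover_def form)
qed

lemma isometric_sum:
  assumes "isometric S S'" "isometric T T'"
  shows "isometric (orthogonal_sum S T) (orthogonal_sum S' T')"
proof -
  obtain f g where f: "isometric_cover S S' f" "inj_on f (carrier S)"
    and g: "isometric_cover T T' g" "inj_on g (carrier T)"
    using assms by (auto simp: isometric_iff_cover)
  have "inj_on (map_prod f g) (carrier S \<times> carrier T)"
    using f(2) g(2) by (rule map_prod_inj_on)
  then show ?thesis
    using isometric_cover_sum[OF f(1) g(1)] by (auto simp: isometric_iff_cover)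
qed

section \<open>Hyperbolic spaces\<close>

lemma hyperbolic_simps [simp]:
  "carrier (hyperbolic_space m) = {x. \<forall>i\<ge>m. x i = 0} \<times> {y. \<forall>i\<ge>m. y i = 0}"
  "\<zero>\<^bsub>hyperbolic_space m\<^esub> = 0"
  "u \<oplus>\<^bsub>hyperbolic_space m\<^esub> v = u + v"
  "c \<odot>\<^bsub>hyperbolic_space m\<^esub> u = (\<lambda>i. c * fst u i, \<lambda>i. c * snd u i)"
  "form (hyperbolic_space m) u v = (\<Sum>i<m. fst u i * snd v i + snd u i * fst v i)"
  by (simp_all add: hyperbolic_space_def split_def)

lemma vectorspace_hyperbolic: "vectorspace class_ring (hyperbolic_space m)"
proof -
  have vs: "vector_space (\<lambda>(c::'a) (x, y). (\<lambda>i::nat. c * x i, \<lambda>i::nat. c * y i))"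
    by unfold_locales (auto simp: fun_eq_iff algebra_simps)
  interpret vector_space "\<lambda>(c::'a) (x, y). (\<lambda>i::nat. c * x i, \<lambda>i::nat. c * y i)" by fact
  show ?thesis
    unfolding hyperbolic_space_def
    by (rule vectorspace_space_on[OF vs]) (auto simp: subspace_def zero_prod_def)
qed

lemma symmetric_bilinear_hyperbolic: "symmetric_bilinear_on (hyperbolic_space m)"
  by (auto simp: symmetric_bilinear_on_def algebra_simps sum.distrib sum_distrib_left)

lemma hyperbolic_nondegenerate: "form_kernel (hyperbolic_space m :: ('f::field, _) form_space) = {0}"
proof
  let ?H = "hyperbolic_space m :: ('f, _) form_space"
  show "{0} \<subseteq> form_kernel ?H" by (auto simp: orthogonal_def zero_prod_def)
  show "form_kernel ?H \<subseteq> {0}"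
  proof
    fix u assume u: "u \<in> form_kernel ?H"
    have "fst u i = 0 \<and> snd u i = 0" for i
    proof (cases "i < m")
      case True
      define e where "e = (\<lambda>j. if j = i then 1 else (0::'f))"
      have "(e, 0) \<in> carrier ?H" "(0, e) \<in> carrier ?H"
        using True by (auto simp: e_def)
      then have "form ?H u (e, 0) = 0" "form ?H u (0, e) = 0"
        using u unfolding orthogonal_def by blast+
      then show ?thesis
        using True by (simp add: e_def if_distrib[of "\<lambda>x. _ * x"] cong: if_cong)
    next
      case False
      then show ?thesis using u by (auto simp: orthogonal_def)
    qed
    then show "u \<in> {0}" by (auto simp: prod_eq_iff fun_eq_iff)
  qed
qed

lemma isometric_sum_hyperbolic_0:
  assumes "vectorspace class_ring S"
  shows "isometric S (orthogonal_sum S (hyperbolic_space 0))"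
proof -
  have "isometric_cover S (orthogonal_sum S (hyperbolic_space 0)) (\<lambda>x. (x, 0))"
    unfolding isometric_cover_def
  proof (intro conjI)
    show "linear_map class_ring S (orthogonal_sum S (hyperbolic_space 0)) (\<lambda>x. (x, 0))"
      by (rule linear_mapI)
        (auto simp: assms vectorspace_orthogonal_sum vectorspace_hyperbolic zero_prod_def zero_fun_def)
  qed (auto simp: zero_prod_def fun_eq_iff)
  then show ?thesis by (auto simp: isometric_iff_cover inj_on_def)
qed

text \<open>Concatenation of coordinate vectors; this is what makes Witt equivalence transitive.\<close>

lemma isometric_sum_hyperbolic_add:
  fixes S :: "('f::field, 'a) form_space"
  assumes S: "vectorspace class_ring S"
  shows "isometric (orthogonal_sum (orthogonal_sum S (hyperbolic_space a)) (hyperbolic_space b))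
    (orthogonal_sum S (hyperbolic_space (a + b)))"
proof -
  let ?P = "orthogonal_sum (orthogonal_sum S (hyperbolic_space a)) (hyperbolic_space b)"
  let ?Q = "orthogonal_sum S (hyperbolic_space (a + b))"
  define j :: "(nat \<Rightarrow> 'f) \<Rightarrow> (nat \<Rightarrow> 'f) \<Rightarrow> nat \<Rightarrow> 'f"
    where "j x x' = (\<lambda>i. if i < a then x i else x' (i - a))" for x x'
  define f where "f = (\<lambda>((s :: 'a, (x, y)), (x', y')). (s, (j x x', j y y')))"
  have j_inj: "j x x' = j z z' \<Longrightarrow> x = z \<and> x' = z'"
    if "\<forall>i\<ge>a. x i = 0" "\<forall>i\<ge>a. z i = 0" for x x' z z'
  proof
    assume eq: "j x x' = j z z'"
    have "x i = z i" for i
      using fun_cong[OF eq, of i] that by (cases "i < a") (auto simp: j_def)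
    then show "x = z" ..
    have "x' i = z' i" for i
      using fun_cong[OF eq, of "i + a"] by (simp add: j_def)
    then show "x' = z'" ..
  qed
  have "isometric_cover ?P ?Q f"
    unfolding isometric_cover_def
  proof (intro conjI ballI)
    show "linear_map class_ring ?P ?Q f"
      by (rule linear_mapI)
        (auto simp: S vectorspace_orthogonal_sum vectorspace_hyperbolic f_def j_def fun_eq_iff)
    show "f ` carrier ?P = carrier ?Q"
    proof
      show "f ` carrier ?P \<subseteq> carrier ?Q" by (auto simp: f_def j_def)
      show "carrier ?Q \<subseteq> f ` carrier ?P"
      proof
        fix u assume u: "u \<in> carrier ?Q"
        obtain s x y where u_eq: "u = (s, (x, y))" by (metis surj_pair)
        define c :: "(nat \<Rightarrow> 'f) \<Rightarrow> nat \<Rightarrow> 'f" where "c x = (\<lambda>i. if i < a then x i else 0)" for x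
        define d :: "(nat \<Rightarrow> 'f) \<Rightarrow> nat \<Rightarrow> 'f" where "d x = (\<lambda>i. x (i + a))" for x
        have "u = f ((s, (c x, c y)), (d x, d y))"
          by (auto simp: u_eq f_def j_def c_def d_def)
        moreover have "((s, (c x, c y)), (d x, d y)) \<in> carrier ?P"
          using u by (auto simp: u_eq c_def d_def)
        ultimately show "u \<in> f ` carrier ?P" by blast
      qed
    qed
    fix u v assume "u \<in> carrier ?P" "v \<in> carrier ?P"
    have split: "(\<Sum>i<a + b. h i) = (\<Sum>i<a. h i) + (\<Sum>i<b. h (i + a))" for h :: "nat \<Rightarrow> 'f"
      by (induction b) (simp_all add: ac_simps)
    show "form ?Q (f u) (f v) = form ?P u v"
      by (auto simp: f_def j_def split_def split add.assoc)
  qed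
  moreover have "inj_on f (carrier ?P)"
  proof (rule inj_onI)
    fix u v assume uv: "u \<in> carrier ?P" "v \<in> carrier ?P" "f u = f v"
    obtain s x y x' y' where u: "u = ((s, (x, y)), (x', y'))" by (metis surj_pair)
    obtain t z w z' w' where v: "v = ((t, (z, w)), (z', w'))" by (metis surj_pair)
    have "x = z \<and> x' = z'" "y = w \<and> y' = w'"
      by (rule j_inj; use uv in \<open>simp add: u v f_def\<close>)+
    then show "u = v" using uv(3) by (simp add: u v f_def)
  qed
  ultimately show ?thesis by (auto simp: isometric_iff_cover)
qed

section \<open>Witt equivalence\<close>

lemma isometric_imp_witt_equivalent: "isometric S T \<Longrightarrow> witt_equivalent S T"
  unfolding witt_equivalent_def
  by (intro exI[of _ 0] isometric_sum isometric_refl vectorspace_hyperbolic)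

lemma witt_equivalent_sym: "witt_equivalent S T \<Longrightarrow> witt_equivalent T S"
  unfolding witt_equivalent_def by (elim exE) (intro exI, erule isometric_sym)

lemma witt_equivalent_trans:
  assumes V: "vectorspace class_ring S" "vectorspace class_ring T" "vectorspace class_ring U"
    and "witt_equivalent S T" "witt_equivalent T U"
  shows "witt_equivalent S U"
proof -
  obtain a b c d
    where ab: "isometric (orthogonal_sum S (hyperbolic_space a)) (orthogonal_sum T (hyperbolic_space b))"
      and cd: "isometric (orthogonal_sum T (hyperbolic_space c)) (orthogonal_sum U (hyperbolic_space d))"
    using assms by (auto simp: witt_equivalent_def)
  note H = isometric_refl[OF vectorspace_hyperbolic]
  note add = isometric_sum_hyperbolic_add
  have "isometric (orthogonal_sum S (hyperbolic_space (a + c))) (orthogonal_sum T (hyperbolic_space (b + c)))"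
    by (rule isometric_trans[OF isometric_trans[OF isometric_sym[OF add[OF V(1)]] isometric_sum[OF ab H]] add[OF V(2)]])
  moreover have "isometric (orthogonal_sum T (hyperbolic_space (c + b))) (orthogonal_sum U (hyperbolic_space (d + b)))"
    by (rule isometric_trans[OF isometric_trans[OF isometric_sym[OF add[OF V(2)]] isometric_sum[OF cd H]] add[OF V(3)]])
  ultimately have "isometric (orthogonal_sum S (hyperbolic_space (a + c))) (orthogonal_sum U (hyperbolic_space (d + b)))"
    by (simp only: add.commute[of c b]) (rule isometric_trans)
  then show ?thesis
    unfolding witt_equivalent_def by (intro exI)
qed

lemma witt_class_eqI:
  fixes S :: "('f::field, 'a) form_space" and T :: "('f, 'b) form_space"
  assumes "quadratic_space S" "quadratic_space T" "witt_equivalent S T"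
  shows "witt_class S = witt_class T"
proof -
  have V: "vectorspace class_ring X" if "quadratic_space X" for X :: "('x::field, 'y) form_space"
    using that by (simp add: quadratic_space_def)
  note V = V[OF assms(1)] V[OF assms(2)] V
  have "witt_equivalent S U \<longleftrightarrow> witt_equivalent T U" if "quadratic_space U" for U :: "('f, nat \<Rightarrow> 'f) form_space"
    using witt_equivalent_trans[OF V(1) V(2) V(3)[OF that] assms(3)]
      witt_equivalent_trans[OF V(2) V(1) V(3)[OF that] witt_equivalent_sym[OF assms(3)]] by blast
  then show ?thesis unfolding witt_class_def by blast
qed

text \<open>Transporting the form along the coordinates of a basis gives an isometric copy of \<open>M\<close> inside
\<open>nat \<Rightarrow> 'f\<close>, the type over which \<open>witt_class\<close> ranges.\<close>

lemma quadratic_space_coordinates: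
  fixes M :: "('f::field, 'a) form_space"
  assumes M: "quadratic_space M"
  shows "\<exists>S :: ('f, nat \<Rightarrow> 'f) form_space. quadratic_space S \<and> isometric M S"
proof -
  interpret vectorspace class_ring M using M by (simp add: quadratic_space_def)
  obtain A where A: "finite A" "basis A"
    using finite_basis_exists M by (auto simp: quadratic_space_def)
  have A': "A \<subseteq> carrier M" "span A = carrier M" "\<not> lin_dep A"
    using A(2) unfolding basis_def by simp_all
  define d where "d = card A"
  obtain idx where idx: "bij_betw idx A {0..<d}"
    using ex_bij_betw_finite_nat[OF A(1)] d_def by blast
  define U where "U = {x :: nat \<Rightarrow> 'f. \<forall>i\<ge>d. x i = 0}"
  define f where "f x = lincomb (\<lambda>v. x (idx v)) A" for x
  define S where "S = space_on (\<lambda>c x i. c * x i) U (\<lambda>x y. form M (f x) (f y))"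
  interpret pw: vector_space "\<lambda>(c::'f) (x :: nat \<Rightarrow> 'f) i. c * x i"
    using vector_space_pointwise[OF vector_space_times] .
  have S: "vectorspace class_ring S"
    unfolding S_def
    by (rule vectorspace_space_on[OF pw.vector_space_axioms]) (auto simp: pw.subspace_def U_def)
  have lin: "linear_map class_ring S M f"
  proof (rule linear_mapI[OF S vectorspace_axioms])
    fix x y assume "x \<in> carrier S" "y \<in> carrier S"
    show "f x \<in> carrier M" unfolding f_def using A' by (intro lincomb_closed) auto
    show "f (x \<oplus>\<^bsub>S\<^esub> y) = f x \<oplus>\<^bsub>M\<^esub> f y"
      using lincomb_sum[OF A(1) A'(1), of "\<lambda>v. x (idx v)" "\<lambda>v. y (idx v)"]
      by (simp add: f_def S_def)
  next
    fix c x assume "x \<in> carrier S"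
    show "f (c \<odot>\<^bsub>S\<^esub> x) = c \<odot>\<^bsub>M\<^esub> f x"
      using lincomb_smult[OF A'(1), of "\<lambda>v. x (idx v)" c]
      by (simp add: f_def S_def)
  qed
  have surj: "f ` U = carrier M"
  proof
    show "f ` U \<subseteq> carrier M" using linear_mapD(3)[OF lin] by (auto simp: S_def)
    show "carrier M \<subseteq> f ` U"
    proof
      fix v assume "v \<in> carrier M"
      then obtain a where a: "lincomb a A = v"
        using finite_in_span[OF A(1) A'(1), of v] A'(2) by auto
      define x where "x i = (if i < d then a (inv_into A idx i) else 0)" for i
      have "x (idx u) = a u" if "u \<in> A" for u
        using that idx inv_into_f_f[of idx A u] bij_betwE[OF idx]
        by (auto simp: x_def bij_betw_def)
      then have "f x = v"
        unfolding f_def a[symmetric] by (intro lincomb_cong) (use A' in auto)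
      moreover have "x \<in> U" by (auto simp: x_def U_def)
      ultimately show "v \<in> f ` U" by blast
    qed
  qed
  have inj: "inj_on f U"
  proof -
    interpret f: linear_map class_ring S M f by (rule lin)
    have "x = 0" if x: "x \<in> U" "f x = \<zero>\<^bsub>M\<^esub>" for x
    proof
      fix i
      have "(\<lambda>v. x (idx v)) \<in> A \<rightarrow> {\<zero>\<^bsub>class_ring\<^esub>}"
        using not_lindepD[OF A'(3) A(1) order.refl] x(2) by (simp add: f_def)
      then have *: "x (idx v) = 0" if "v \<in> A" for v using that by auto
      show "x i = 0 i"
      proof (cases "i < d")
        case True
        then obtain v where "v \<in> A" "i = idx v"
          using idx unfolding bij_betw_def by (metis atLeastLessThan_iff imageE le0)
        then show ?thesis using * by simp
      next
        case False
        then show ?thesis using x(1) by (simp add: U_def)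
      qed
    qed
    then have "carrier (S\<lparr>carrier := f.kerT\<rparr>) = {\<zero>\<^bsub>S\<^esub>}"
      using f.T0_is_0 unfolding f.ker_def by (auto simp: S_def U_def)
    then show ?thesis using f.Ke0_imp_inj by (simp add: S_def)
  qed
  have "isometric_cover S M f" "inj_on f (carrier S)"
    using lin surj inj unfolding isometric_cover_def S_def space_on_simps by blast+
  then have MS: "isometric M S"
    unfolding isometric_iff_cover[of S M] using isometric_sym isometric_iff_cover by blast
  then obtain g where g: "isometric_cover M S g"
    unfolding isometric_iff_cover by blast
  have "quadratic_space S"
  proof (rule quadratic_space_of_cover[OF g])
    show "symmetric_bilinear_on M" "fin_dim" using M by (auto simp: quadratic_space_def)
    show "g x = \<zero>\<^bsub>S\<^esub>" if "x \<in> form_kernel M" for x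
    proof -
      have "x = \<zero>\<^bsub>M\<^esub>" using that M by (simp add: quadratic_space_def)
      then show ?thesis
        using linear_mapD(6)[of M S g] g unfolding isometric_cover_def by blast
    qed
  qed
  then show ?thesis using MS by blast
qed

lemma witt_class_in_witt_group:
  fixes M :: "('f::field, 'a) form_space"
  assumes "quadratic_space M"
  shows "witt_class M \<in> carrier witt_group"
proof -
  obtain S :: "('f, nat \<Rightarrow> 'f) form_space" where S: "quadratic_space S" "isometric M S"
    using quadratic_space_coordinates[OF assms] by blast
  have "witt_class M = witt_class S"
    by (rule witt_class_eqI[OF assms S(1) isometric_imp_witt_equivalent[OF S(2)]])
  then show ?thesis using S(1) by (auto simp: witt_group_def)
qed

section \<open>Dimension\<close>

text \<open>A relation rather than a value, because \<open>vector_space.dim\<close> is \<open>0\<close> also for infinite-dimensional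
spaces: the ambient types \<open>nat \<Rightarrow> 'v\<close> and \<open>'v \<Rightarrow> 'f\<close> are infinite-dimensional in general.\<close>

definition has_dimension :: "('f::field \<Rightarrow> 'v::ab_group_add \<Rightarrow> 'v) \<Rightarrow> 'v set \<Rightarrow> nat \<Rightarrow> bool" where
  "has_dimension scl S d \<longleftrightarrow>
     (\<exists>A. finite A \<and> \<not> Modules.module.dependent scl A \<and> Modules.module.span scl A = S \<and> card A = d)"

context vector_space
begin

lemma has_dimensionD:
  assumes "has_dimension scale S d"
  shows "subspace S" "vector_space.dim scale S = d"
  using assms subspace_span dim_span_eq_card_independent by (auto simp: has_dimension_def)

lemma has_dimension_subspace:
  assumes "has_dimension scale S d" "subspace U" "U \<subseteq> S"
  shows "has_dimension scale U (vector_space.dim scale U)" "vector_space.dim scale U \<le> d"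
proof -
  obtain A where A: "finite A" "span A = S" "card A = d"
    using assms by (auto simp: has_dimension_def)
  obtain C where C: "C \<subseteq> U" "independent C" "U \<subseteq> span C"
    using maximal_independent_subset[of U] by blast
  have "span C = U" using C span_minimal[OF C(1) assms(2)] by blast
  moreover have "finite C \<and> card C \<le> card A"
    by (rule independent_span_bound[OF A(1) C(2)]) (use C assms A in auto)
  ultimately show "has_dimension scale U (vector_space.dim scale U)" "vector_space.dim scale U \<le> d"
    using C dim_span_eq_card_independent[OF C(2)] A(3) unfolding has_dimension_def by auto
qed

lemma has_dimension_psubset:
  assumes "has_dimension scale S d" "subspace U" "U \<subseteq> S" "U \<noteq> S"
  shows "vector_space.dim scale U < d"
proof -
  obtain A where A: "finite A" "independent A" "span A = U" "card A = vector_space.dim scale U"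
    using has_dimension_subspace(1)[OF assms(1-3)] by (auto simp: has_dimension_def)
  obtain x where x: "x \<in> S" "x \<notin> U" using assms by blast
  obtain D where D: "finite D" "span D = S" "card D = d"
    using assms by (auto simp: has_dimension_def)
  have "independent (insert x A)"
    using x A by (intro independent_insertI) auto
  moreover have "insert x A \<subseteq> span D"
    using x A assms span_superset[of A] D by auto
  ultimately have "card (insert x A) \<le> d"
    using independent_span_bound[OF D(1)] D(3) by blast
  moreover have "x \<notin> A" using x A span_superset[of A] by auto
  ultimately show ?thesis using A by simp
qed

text \<open>A basis in the sense of \<open>vector_space\<close> is a basis of the corresponding module record, so both notions
of dimension agree.\<close>

lemma space_on_dimension:
  assumes "has_dimension scale S d"
  shows "vectorspace.fin_dim class_ring (space_on scale S q)"
    and "vectorspace.dim class_ring (space_on scale S q) = d"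
proof -
  let ?M = "space_on scale S q"
  obtain A where A: "finite A" "independent A" "span A = S" "card A = d"
    using assms by (auto simp: has_dimension_def)
  have AS: "A \<subseteq> S" using A span_superset by blast
  interpret M: vectorspace class_ring ?M
    by (rule vectorspace_space_on[OF vector_space_axioms has_dimensionD(1)[OF assms]])
  have finsum: "finsum ?M f C = sum f C" if "finite C" "f ` C \<subseteq> S" for f and C :: "'b set"
    using that by (induction C) (simp_all add: M.finsum_insert image_subset_iff Pi_iff)
  have lincomb: "M.lincomb a A = (\<Sum>v\<in>A. scale (a v) v)" for a
    unfolding M.lincomb_def space_on_simps
    by (rule finsum[OF A(1)]) (use AS subspace_scale[OF has_dimensionD(1)[OF assms]] in auto)
  have "M.span A = S"
    using M.finite_span[of A] A AS lincomb by (auto simp: span_finite[OF A(1)])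
  moreover have "M.lin_indpt A"
    by (rule M.finite_lin_indpt2)
      (use A AS lincomb independentD[OF A(2) A(1) order.refl] in auto)
  ultimately have basis: "M.basis A" using AS by (simp add: M.basis_def)
  show "M.fin_dim" using A(1) AS \<open>M.span A = S\<close> unfolding M.fin_dim_def by auto
  show "M.dim = d" using M.dim_basis[OF A(1) basis] A(4) by simp
qed

end

context vector_space_pair
begin

text \<open>Rank-nullity read from right to left: the finiteness of \<open>S\<close> is a conclusion, obtained from a basis of
the kernel together with preimages of a basis of the image.\<close>

lemma has_dimension_kernel_image:
  assumes f: "Vector_Spaces.linear s1 s2 f" and S: "vs1.subspace S"
    and ker: "has_dimension s1 {x \<in> S. f x = 0} k" and img: "has_dimension s2 (f ` S) r"
  shows "has_dimension s1 S (k + r)"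
proof -
  interpret f: Vector_Spaces.linear s1 s2 f by fact
  obtain A where A: "finite A" "vs1.independent A" "vs1.span A = {x \<in> S. f x = 0}" "card A = k"
    using ker by (auto simp: has_dimension_def)
  obtain C where C: "finite C" "vs2.independent C" "vs2.span C = f ` S" "card C = r"
    using img by (auto simp: has_dimension_def)
  have "\<forall>c\<in>C. \<exists>s\<in>S. f s = c" using C(3) vs2.span_superset[of C] by auto
  then obtain g where g: "\<And>c. c \<in> C \<Longrightarrow> g c \<in> S" "\<And>c. c \<in> C \<Longrightarrow> f (g c) = c"
    by metis
  have inj: "inj_on g C" using g(2) by (metis inj_onI)
  have A0: "f x = 0" "x \<in> S" if "x \<in> A" for x
    using that A(3) vs1.span_superset[of A] by auto
  have C0: "0 \<notin> C" using C(2) vs2.dependent_zero by blast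
  have disj: "A \<inter> g ` C = {}" using A0 g(2) C0 by fastforce
  have split: "(\<Sum>x\<in>A \<union> g ` C. u x) = (\<Sum>x\<in>A. u x) + (\<Sum>c\<in>C. u (g c))" for u :: "'b \<Rightarrow> 'b"
    using A(1) C(1) disj inj by (simp add: sum.union_disjoint sum.reindex o_def)
  have "vs1.independent (A \<union> g ` C)"
  proof (rule vs1.independent_if_scalars_zero)
    show "finite (A \<union> g ` C)" using A C by simp
    fix u x assume sum0: "(\<Sum>x\<in>A \<union> g ` C. s1 (u x) x) = 0" and x: "x \<in> A \<union> g ` C"
    have "0 = f (\<Sum>x\<in>A \<union> g ` C. s1 (u x) x)" using sum0 by (simp add: f.zero)
    also have "\<dots> = (\<Sum>c\<in>C. s2 (u (g c)) c)"
      using A0 g(2) by (simp add: split f.add f.sum f.scale)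
    finally have uC: "u (g c) = 0" if "c \<in> C" for c
      using vs2.independentD[OF C(2) C(1) order.refl, of "\<lambda>c. u (g c)" c] that by simp
    then have "(\<Sum>x\<in>A. s1 (u x) x) = 0" using sum0 by (simp add: split)
    then have "u x = 0" if "x \<in> A" for x
      using vs1.independentD[OF A(2) A(1) order.refl, of u x] that by simp
    then show "u x = 0" using x uC by auto
  qed
  moreover have "vs1.span (A \<union> g ` C) = S"
  proof
    show "vs1.span (A \<union> g ` C) \<subseteq> S"
      by (rule vs1.span_minimal[OF _ S]) (use A0 g(1) in auto)
    show "S \<subseteq> vs1.span (A \<union> g ` C)"
    proof
      fix x assume x: "x \<in> S"
      then have "f x \<in> vs2.span C" using C by auto
      then obtain b where b: "f x = (\<Sum>c\<in>C. s2 (b c) c)"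
        using vs2.span_finite[OF C(1)] by auto
      define y where "y = (\<Sum>c\<in>C. s1 (b c) (g c))"
      have y: "y \<in> vs1.span (g ` C)"
        unfolding y_def by (intro vs1.span_sum vs1.span_scale vs1.span_base) simp
      have "y \<in> S"
        unfolding y_def by (intro vs1.subspace_sum vs1.subspace_scale S g(1))
      moreover have "f y = f x" using g(2) by (simp add: y_def b f.sum f.scale)
      ultimately have "x - y \<in> vs1.span A"
        using x vs1.subspace_diff[OF S] A(3) by (simp add: f.diff)
      then have "(x - y) + y \<in> vs1.span (A \<union> g ` C)"
        using y vs1.span_mono[of A "A \<union> g ` C"] vs1.span_mono[of "g ` C" "A \<union> g ` C"]
        by (intro vs1.span_add) auto
      then show "x \<in> vs1.span (A \<union> g ` C)" by simp
    qed
  qed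
  moreover have "card (A \<union> g ` C) = k + r"
    using A C disj inj by (simp add: card_Un_disjoint card_image)
  ultimately show ?thesis
    using A(1) C(1) unfolding has_dimension_def by (intro exI[of _ "A \<union> g ` C"]) simp
qed

lemma has_dimension_inj_image:
  assumes f: "Vector_Spaces.linear s1 s2 f" and S: "has_dimension s1 S d" and inj: "inj_on f S"
  shows "has_dimension s2 (f ` S) d"
proof -
  interpret f: Vector_Spaces.linear s1 s2 f by fact
  obtain A where A: "finite A" "vs1.independent A" "vs1.span A = S" "card A = d"
    using S by (auto simp: has_dimension_def)
  have "inj_on f A" using inj A(3) vs1.span_superset[of A] by (auto intro: inj_on_subset)
  then show ?thesis
    using A f.independent_injective_image[OF A(2)] inj f.span_image[of A]
    unfolding has_dimension_def by (metis card_image finite_imageI)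
qed

end

section \<open>Splitting off hyperbolic planes along an isotropic subspace\<close>

locale symmetric_form = vector_space scale
  for scale :: "'f::field \<Rightarrow> 'v::ab_group_add \<Rightarrow> 'v" (infixr \<open>*s\<close> 75) +
  fixes U :: "'v set" and Q :: "'v \<Rightarrow> 'v \<Rightarrow> 'f"
  assumes subspace_U: "subspace U"
    and symmetric_bilinear: "symmetric_bilinear_on (space_on scale U Q)"
begin

lemma U_closed [simp]:
  "0 \<in> U" "x \<in> U \<Longrightarrow> y \<in> U \<Longrightarrow> x + y \<in> U" "x \<in> U \<Longrightarrow> y \<in> U \<Longrightarrow> x - y \<in> U" "x \<in> U \<Longrightarrow> c *s x \<in> U"
  using subspace_U by (simp_all add: subspace_0 subspace_add subspace_diff subspace_scale)

lemma U_sum [simp]: "(\<And>i. i \<in> A \<Longrightarrow> g i \<in> U) \<Longrightarrow> sum g A \<in> U"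
  by (rule subspace_sum[OF subspace_U])

lemma Q_sym: "x \<in> U \<Longrightarrow> y \<in> U \<Longrightarrow> Q x y = Q y x"
  and Q_add_left: "x \<in> U \<Longrightarrow> y \<in> U \<Longrightarrow> z \<in> U \<Longrightarrow> Q (x + y) z = Q x z + Q y z"
  and Q_scale_left: "x \<in> U \<Longrightarrow> z \<in> U \<Longrightarrow> Q (c *s x) z = c * Q x z"
  using symmetric_bilinear by (auto simp: symmetric_bilinear_on_def)

lemma Q_add_right: "x \<in> U \<Longrightarrow> y \<in> U \<Longrightarrow> z \<in> U \<Longrightarrow> Q z (x + y) = Q z x + Q z y"
  and Q_scale_right: "x \<in> U \<Longrightarrow> z \<in> U \<Longrightarrow> Q z (c *s x) = c * Q z x"
  by (simp_all add: Q_sym[of z] Q_add_left Q_scale_left)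

lemma Q_zero: "x \<in> U \<Longrightarrow> Q 0 x = 0" "x \<in> U \<Longrightarrow> Q x 0 = 0"
  using Q_scale_left[of x x 0] Q_scale_right[of x x 0] by simp_all

lemma Q_diff_left: "x \<in> U \<Longrightarrow> y \<in> U \<Longrightarrow> z \<in> U \<Longrightarrow> Q (x - y) z = Q x z - Q y z"
  using Q_add_left[of "x - y" y z] by simp

lemma Q_diff_right: "x \<in> U \<Longrightarrow> y \<in> U \<Longrightarrow> z \<in> U \<Longrightarrow> Q z (x - y) = Q z x - Q z y"
  using Q_add_right[of "x - y" y z] by simp

lemma Q_sum_left: "(\<And>i. i \<in> A \<Longrightarrow> g i \<in> U) \<Longrightarrow> z \<in> U \<Longrightarrow> Q (\<Sum>i\<in>A. g i) z = (\<Sum>i\<in>A. Q (g i) z)"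
  by (induction A rule: infinite_finite_induct) (simp_all add: Q_zero Q_add_left)

lemma Q_sum_right: "(\<And>i. i \<in> A \<Longrightarrow> g i \<in> U) \<Longrightarrow> z \<in> U \<Longrightarrow> Q z (\<Sum>i\<in>A. g i) = (\<Sum>i\<in>A. Q z (g i))"
  by (induction A rule: infinite_finite_induct) (simp_all add: Q_zero Q_add_right)

lemmas Q_simps = Q_add_left Q_add_right Q_scale_left Q_scale_right Q_zero Q_diff_left Q_diff_right

abbreviation radical :: "'v set" where
  "radical \<equiv> form_kernel (space_on scale U Q)"

text \<open>The last clause says that, up to the kernel of the form, \<open>I\<close> is spanned by the \<open>e k\<close>: the rest of \<open>I\<close>
is invisible to the form.\<close>

definition hyperbolic_pairs :: "nat \<Rightarrow> 'v set \<Rightarrow> (nat \<Rightarrow> 'v) \<Rightarrow> (nat \<Rightarrow> 'v) \<Rightarrow> bool" where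
  "hyperbolic_pairs m I e f \<longleftrightarrow>
     (\<forall>k<m. e k \<in> I \<and> f k \<in> U) \<and>
     (\<forall>j<m. \<forall>k<m. Q (e j) (f k) = (if j = k then 1 else 0) \<and> Q (f j) (f k) = 0) \<and>
     (\<forall>u\<in>I. (\<forall>k<m. Q u (f k) = 0) \<longrightarrow> u \<in> radical)"

end

text \<open>Induction on \<open>dim I\<close>. A vector \<open>e\<close> of \<open>I\<close> outside the kernel has a partner \<open>f\<close> with \<open>Q e f = 1\<close>, which
can be made isotropic by subtracting a multiple of \<open>e\<close>. The orthogonal complement of this hyperbolic
plane contains the smaller isotropic subspace \<open>I \<inter> f\<^sup>\<bottom>\<close>.\<close>

lemma hyperbolic_pairs_exist:
  fixes scale :: "'f::field \<Rightarrow> 'v::ab_group_add \<Rightarrow> 'v"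
  assumes "symmetric_form scale U Q" and two: "(2::'f) \<noteq> 0"
    and "has_dimension scale I d" "isotropic_subspace (space_on scale U Q) I"
  shows "\<exists>m e f. symmetric_form.hyperbolic_pairs scale U Q m I e f"
  using assms(1,3,4)
proof (induction d arbitrary: U I rule: less_induct)
  case (less d)
  interpret symmetric_form scale U Q by fact
  note I = has_dimensionD(1)[OF less.prems(2)]
  have IU: "x \<in> U" if "x \<in> I" for x
    using less.prems(3) that
    by (auto simp: isotropic_subspace_def VectorSpace.subspace_def submodule_def)
  have iso: "Q x y = 0" if "x \<in> I" "y \<in> I" for x y
    using less.prems(3) that by (auto simp: isotropic_subspace_def)
  show ?case
  proof (cases "I \<subseteq> radical")
    case True
    then have "hyperbolic_pairs 0 I e f" for e f
      by (auto simp: hyperbolic_pairs_def)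
    then show ?thesis by blast
  next
    case False
    then obtain e0 g where e0: "e0 \<in> I" and g: "g \<in> U" and "Q e0 g \<noteq> 0"
      using IU by (auto simp: orthogonal_def)
    have e0U: "e0 \<in> U" using e0 IU by simp
    define g1 where "g1 = scale (inverse (Q e0 g)) g"
    have g1: "g1 \<in> U" "Q e0 g1 = 1"
      using g e0U \<open>Q e0 g \<noteq> 0\<close> by (simp_all add: g1_def Q_scale_right)
    \<comment> \<open>The multiple of \<open>e0\<close> is chosen to make \<open>f0\<close> isotropic; this needs \<open>2 \<noteq> 0\<close>.\<close>
    define f0 where "f0 = g1 - scale (Q g1 g1 / 2) e0"
    have f0U: "f0 \<in> U" using g1 e0U by (simp add: f0_def)
    have ef: "Q e0 f0 = 1"
      using g1 e0U iso[OF e0 e0] by (simp add: f0_def Q_simps)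
    have fe: "Q f0 e0 = 1" using ef Q_sym e0U f0U by simp
    have ff: "Q f0 f0 = 0"
      using g1 e0U iso[OF e0 e0] two Q_sym[OF g1(1) e0U]
      by (simp add: f0_def Q_simps field_simps)
    define U' where "U' = {x \<in> U. Q x e0 = 0 \<and> Q x f0 = 0}"
    define I' where "I' = {x \<in> I. Q x f0 = 0}"
    have I': "I' \<subseteq> U'" "I' \<subseteq> I" using IU iso e0 by (auto simp: I'_def U'_def)
    have sub_I': "subspace I'"
      using I IU f0U by (auto simp: I'_def subspace_def Q_simps)
    have sub_U': "subspace U'"
      using e0U f0U by (auto simp: U'_def subspace_def Q_simps)
    have sf': "symmetric_form scale U' Q"
    proof
      show "symmetric_bilinear_on (space_on scale U' Q)"
        using symmetric_bilinear by (auto simp: symmetric_bilinear_on_def U'_def)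
    qed (rule sub_U')
    have "e0 \<notin> I'" using ef by (simp add: I'_def)
    then have "vector_space.dim scale I' < d"
      by (intro has_dimension_psubset[OF less.prems(2) sub_I' I'(2)]) (use e0 in auto)
    moreover have "has_dimension scale I' (vector_space.dim scale I')"
      by (rule has_dimension_subspace[OF less.prems(2) sub_I' I'(2)])
    moreover have "isotropic_subspace (space_on scale U' Q) I'"
      unfolding isotropic_subspace_def VectorSpace.subspace_def
    proof (intro conjI ballI)
      show V: "vectorspace class_ring (space_on scale U' Q)"
        by (rule vectorspace_space_on[OF vector_space_axioms sub_U'])
      then have "Module.module class_ring (space_on scale U' Q)"
        by (simp add: vectorspace_def)
      then show "submodule class_ring I' (space_on scale U' Q)"
        using I'(1) sub_I' by (simp add: submodule_def subspace_def)
    qed (use iso I' in auto)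
    ultimately obtain m e f where ef': "symmetric_form.hyperbolic_pairs scale U' Q m I' e f"
      using less.IH[OF _ sf'] by blast
    note hp = ef'[unfolded symmetric_form.hyperbolic_pairs_def[OF sf']]
    define e' where "e' = e(m := e0)"
    define f' where "f' = f(m := f0)"
    have mem: "e k \<in> I" "Q (e k) f0 = 0" "f k \<in> U" "Q (f k) e0 = 0" "Q (f k) f0 = 0"
        "Q e0 (f k) = 0" "Q f0 (f k) = 0" if "k < m" for k
      using hp that e0U f0U Q_sym[of _ e0] Q_sym[of _ f0] unfolding I'_def U'_def by auto
    have "hyperbolic_pairs (Suc m) I e' f'"
      unfolding hyperbolic_pairs_def
    proof (intro conjI allI impI ballI)
      show "e' k \<in> I" "f' k \<in> U" if "k < Suc m" for k
        using that mem e0 f0U by (auto simp: e'_def f'_def less_Suc_eq)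
      show "Q (e' j) (f' k) = (if j = k then 1 else 0)" "Q (f' j) (f' k) = 0"
        if "j < Suc m" "k < Suc m" for j k
        using that mem ef ff hp by (auto simp: e'_def f'_def less_Suc_eq)
    next
      fix u assume u: "u \<in> I" and orth: "\<forall>k<Suc m. Q u (f' k) = 0"
      have "u \<in> I'" using orth u by (auto simp: I'_def f'_def)
      moreover have "\<forall>k<m. Q u (f k) = 0"
        using orth by (auto simp: f'_def less_Suc_eq split: if_splits)
      ultimately have rad': "u \<in> form_kernel (space_on scale U' Q)" using hp by blast
      have "Q u x = 0" if x: "x \<in> U" for x
      proof -
        \<comment> \<open>Projecting \<open>x\<close> to \<open>U'\<close> subtracts vectors that \<open>u\<close> is orthogonal to.\<close>
        define x' where "x' = x - (scale (Q x f0) e0 + scale (Q x e0) f0)"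
        have "x' \<in> U'"
          using x e0U f0U ef fe ff iso[OF e0 e0] by (simp add: x'_def U'_def Q_simps)
        then have "Q u x' = 0" using rad' by (simp add: orthogonal_def)
        moreover have "Q u x' = Q u x"
          using x e0U f0U IU[OF u] iso[OF u e0] \<open>u \<in> I'\<close> by (simp add: x'_def I'_def Q_simps)
        ultimately show ?thesis by simp
      qed
      then show "u \<in> radical" using IU[OF u] by (simp add: orthogonal_def)
    qed
    then show ?thesis by blast
  qed
qed

context symmetric_form
begin

text \<open>With hyperbolic pairs for \<open>I\<close>, every \<open>w\<close> in the orthogonal complement of \<open>I\<close> can be moved along \<open>I\<close> to
the vector \<open>p w\<close> that is also orthogonal to all \<open>f k\<close>. Such vectors and the hyperbolic planes are
orthogonal and together fill \<open>U\<close>; moving along \<open>I\<close> does not change the form on its complement. If the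
form is non-degenerate, this induces an isometry of \<open>U\<close> with the sum of the subquotient by \<open>I\<close> and
a hyperbolic space. The second claim is what makes the subquotient non-degenerate.\<close>

theorem hyperbolic_cover:
  fixes I :: "'v set"
  assumes iso: "isotropic_subspace (space_on scale U Q) I"
    and pairs: "hyperbolic_pairs m I e f"
  defines "P \<equiv> orthogonal (space_on scale U Q) I"
  shows "\<exists>F. isometric_cover (orthogonal_sum (space_on scale P Q) (hyperbolic_space m))
              (space_on scale U Q) F"
    and "\<And>w. w \<in> form_kernel (space_on scale P Q) \<Longrightarrow> \<exists>v\<in>I. w - v \<in> radical"
proof -
  have IU: "x \<in> U" if "x \<in> I" for x
    using iso that by (auto simp: isotropic_subspace_def VectorSpace.subspace_def submodule_def)
  have I: "subspace I"
    using iso by (auto simp: isotropic_subspace_def VectorSpace.subspace_def submodule_def subspace_def)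
  have iso: "Q x y = 0" if "x \<in> I" "y \<in> I" for x y
    using iso that by (auto simp: isotropic_subspace_def)
  have eI: "e k \<in> I" and eU [simp]: "e k \<in> U" and fU [simp]: "f k \<in> U" if "k < m" for k
    using pairs IU that by (auto simp: hyperbolic_pairs_def)
  have ef: "Q (e j) (f k) = (if j = k then 1 else 0)" and ff: "Q (f j) (f k) = 0"
    if "j < m" "k < m" for j k
    using pairs that by (auto simp: hyperbolic_pairs_def)
  have fe: "Q (f j) (e k) = (if j = k then 1 else 0)" if "j < m" "k < m" for j k
    using ef[OF that(2,1)] Q_sym[of "f j" "e k"] that by auto
  have rad: "u \<in> radical" if "u \<in> I" "\<And>k. k < m \<Longrightarrow> Q u (f k) = 0" for u
    using pairs that by (auto simp: hyperbolic_pairs_def)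
  have P: "w \<in> U" "\<And>x. x \<in> I \<Longrightarrow> Q w x = 0" if "w \<in> P" for w
    using that by (auto simp: P_def orthogonal_def)
  have sub_P: "subspace P"
    unfolding P_def orthogonal_def using IU by (auto simp: subspace_def Q_simps)
  define p where "p w = w - (\<Sum>k<m. Q w (f k) *s e k)" for w
  define h where "h x y = (\<Sum>k<m. x k *s e k + y k *s f k)" for x y
  have eSum [simp]: "(\<Sum>k<m. c k *s e k) \<in> U" for c
    by (rule U_sum) simp
  have Q_eSum: "Q (\<Sum>k<m. c k *s e k) z = (\<Sum>k<m. c k * Q (e k) z)"
    "Q z (\<Sum>k<m. c k *s e k) = (\<Sum>k<m. c k * Q z (e k))" if "z \<in> U" for c z
    using that by (subst Q_sum_left Q_sum_right; simp add: Q_simps)+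
  have hU [simp]: "h x y \<in> U" for x y
    unfolding h_def by (rule U_sum) simp
  have Q_h: "Q (h x y) z = (\<Sum>k<m. x k * Q (e k) z + y k * Q (f k) z)"
    "Q z (h x y) = (\<Sum>k<m. x k * Q z (e k) + y k * Q z (f k))" if "z \<in> U" for x y z
    unfolding h_def using that by (subst Q_sum_left Q_sum_right; simp add: Q_simps)+
  have pU [simp]: "p w \<in> U" if "w \<in> U" for w
    using that by (simp add: p_def)
  have delta: "(\<Sum>k<m. a k * (if k = j then 1 else 0)) = a j" "(\<Sum>k<m. a k * (if j = k then 1 else 0)) = a j"
    if "j < m" for a :: "nat \<Rightarrow> 'f" and j
    using that by (simp_all add: if_distrib[of "\<lambda>x. _ * x"] cong: if_cong)
  have he: "Q (h x y) (e j) = y j" and hf: "Q (h x y) (f j) = x j" if "j < m" for x y j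
    using that by (simp_all add: Q_h ef fe ff iso eI delta)
  have pe: "Q (p w) (e j) = 0" if "w \<in> P" "j < m" for w j
    using P[OF that(1)] that by (simp add: p_def Q_diff_left Q_eSum iso eI)
  have pf: "Q (p w) (f j) = 0" if "w \<in> P" "j < m" for w j
    using P[OF that(1)] that by (simp add: p_def Q_diff_left Q_eSum ef delta)
  have ph: "Q (p w) (h x y) = 0" if "w \<in> P" for w x y
    using P[OF that] that by (simp add: Q_h pe pf)
  have pp: "Q (p w) (p w') = Q w w'" if w: "w \<in> P" "w' \<in> P" for w w'
  proof -
    have "Q (p w) (p w') = Q (p w) w'"
      using P[OF w(1)] P[OF w(2)] w unfolding p_def[of w'] by (simp add: Q_diff_right Q_eSum pe)
    also have "\<dots> = Q w w' - (\<Sum>k<m. Q w (f k) * Q (e k) w')"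
      using P(1)[OF w(1)] P(1)[OF w(2)] unfolding p_def by (simp add: Q_diff_left Q_eSum)
    also have "\<dots> = Q w w'"
      using P[OF w(2)] by (simp add: Q_sym[of "e _" w'] eI)
    finally show ?thesis .
  qed
  have hh: "Q (h x y) (h x' y') = (\<Sum>k<m. x k * y' k + y k * x' k)" for x y x' y'
    by (simp add: Q_h(2) he hf mult.commute add.commute)
  define F where "F = (\<lambda>(w, (x, y)). p w + h x y)"
  let ?P = "orthogonal_sum (space_on scale P Q) (hyperbolic_space m)"
  let ?U = "space_on scale U Q"
  have cover: "isometric_cover ?P ?U F"
    unfolding isometric_cover_def
  proof (intro conjI ballI)
    show "linear_map class_ring ?P ?U F"
    proof (rule linear_mapI)
      show "vectorspace class_ring ?P"
        by (intro vectorspace_orthogonal_sum vectorspace_hyperbolic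
            vectorspace_space_on[OF vector_space_axioms sub_P])
      show "vectorspace class_ring ?U"
        by (rule vectorspace_space_on[OF vector_space_axioms subspace_U])
      show "F u \<in> carrier ?U" if "u \<in> carrier ?P" for u
        using that P(1) by (auto simp: F_def)
      show "F (u \<oplus>\<^bsub>?P\<^esub> v) = F u \<oplus>\<^bsub>?U\<^esub> F v" if "u \<in> carrier ?P" "v \<in> carrier ?P" for u v
        using that P(1)
        by (auto simp: F_def p_def h_def Q_simps scale_left_distrib sum.distrib split_def)
      show "F (c \<odot>\<^bsub>?P\<^esub> u) = c \<odot>\<^bsub>?U\<^esub> F u" if "u \<in> carrier ?P" for c u
        using that P(1)
        by (auto simp: F_def p_def h_def Q_simps scale_right_distrib scale_right_diff_distrib
            scale_sum_right split_def)
    qed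
    show "F ` carrier ?P = carrier ?U"
    proof
      show "F ` carrier ?P \<subseteq> carrier ?U" using P(1) by (auto simp: F_def)
      show "carrier ?U \<subseteq> F ` carrier ?P"
      proof
        fix u assume "u \<in> carrier ?U"
        then have u: "u \<in> U" by simp
        define x where "x k = (if k < m then Q u (f k) else 0)" for k
        define y where "y k = (if k < m then Q u (e k) else 0)" for k
        define w where "w = u - h x y"
        have wU: "w \<in> U" using u by (simp add: w_def)
        have we: "Q w (e k) = 0" and wf: "Q w (f k) = 0" if "k < m" for k
          using that u by (simp_all add: w_def Q_simps he hf x_def y_def)
        have "Q w v = 0" if v: "v \<in> I" for v
        proof -
          have vU: "v \<in> U" using IU v by simp
          \<comment> \<open>Up to a vector \<open>r\<close> of the kernel, \<open>v\<close> is a combination of the \<open>e k\<close>.\<close>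
          define r where "r = v - (\<Sum>k<m. Q v (f k) *s e k)"
          have "r \<in> I"
            unfolding r_def using I v eI by (intro subspace_diff subspace_sum subspace_scale) auto
          moreover have "Q r (f k) = 0" if "k < m" for k
            using that vU by (simp add: r_def Q_diff_left Q_eSum ef delta)
          ultimately have "r \<in> radical" by (rule rad)
          then have "Q r w = 0" "r \<in> U" using wU by (auto simp: orthogonal_def)
          then have "Q w r = 0" using Q_sym[OF wU] by simp
          moreover have "Q w r = Q w v"
            using wU vU by (simp add: r_def Q_diff_right Q_eSum we)
          ultimately show ?thesis by simp
        qed
        then have "w \<in> P" using wU by (simp add: P_def orthogonal_def)
        moreover have "p w = w" by (simp add: p_def wf)
        ultimately have "(w, (x, y)) \<in> carrier ?P" "F (w, (x, y)) = u"
          by (auto simp: x_def y_def F_def w_def)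
        then show "u \<in> F ` carrier ?P" by (metis imageI)
      qed
    qed
    show "form ?U (F u) (F v) = form ?P u v" if "u \<in> carrier ?P" "v \<in> carrier ?P" for u v
      using that P(1)
      by (auto simp: F_def Q_simps pp ph hh Q_sym[of "h _ _" "p _"])
  qed
  show "\<exists>F. isometric_cover ?P ?U F"
    by (rule exI[of _ F]) (rule cover)
  show "\<exists>v\<in>I. w - v \<in> radical" if w: "w \<in> form_kernel (space_on scale P Q)" for w
  proof (rule bexI)
    have wP: "w \<in> P" and orth: "\<And>w'. w' \<in> P \<Longrightarrow> Q w w' = 0"
      using w by (auto simp: orthogonal_def)
    have "Q (p w) u = 0" if "u \<in> U" for u
    proof -
      have "u \<in> F ` carrier ?P"
        using cover that by (simp add: isometric_cover_def)
      then obtain w' x y where "w' \<in> P" "u = p w' + h x y"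
        by (auto simp: F_def)
      then show ?thesis
        using wP P(1) orth by (simp add: Q_simps pp ph)
    qed
    then show "w - (\<Sum>k<m. Q w (f k) *s e k) \<in> radical"
      using P(1)[OF wP] pU[of w] by (simp add: orthogonal_def p_def)
    show "(\<Sum>k<m. Q w (f k) *s e k) \<in> I"
      using I eI by (intro subspace_sum subspace_scale) auto
  qed
qed

end

section \<open>Symplectic spaces and Lagrangians\<close>

locale symplectic_space = finite_dimensional_vector_space scale Basis
  for scale :: "'f::field \<Rightarrow> 'v::ab_group_add \<Rightarrow> 'v" and Basis +
  fixes B :: "'v \<Rightarrow> 'v \<Rightarrow> 'f"
  assumes symplectic: "symplectic_form scale B"
begin

lemma B_add_left: "B (x + y) z = B x z + B y z"
  and B_add_right: "B z (x + y) = B z x + B z y"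
  and B_scale_left: "B (scale c x) z = c * B x z"
  and B_scale_right: "B z (scale c x) = c * B z x"
  and B_self: "B x x = 0"
  and B_nondegenerate: "(\<And>w. B x w = 0) \<Longrightarrow> x = 0"
  using symplectic by (auto simp: symplectic_form_def Vector_Spaces.linear_iff)

lemma B_skew: "B x y = - B y x"
proof -
  have "B (x + y) (x + y) = B x y + B y x"
    unfolding B_add_left B_add_right by (simp add: B_self)
  then show ?thesis by (simp add: B_self eq_neg_iff_add_eq_0)
qed

lemma B_zero [simp]: "B 0 x = 0" "B x 0 = 0"
  using B_scale_left[of 0 0 x] B_scale_right[of x 0 0] by simp_all

lemma B_minus: "B (- x) y = - B x y" "B x (- y) = - B x y"
  using B_add_left[of x "- x" y] B_add_right[of x y "- y"] by (simp_all add: eq_neg_iff_add_eq_0 add.commute)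

lemma B_diff: "B (x - y) z = B x z - B y z" "B z (x - y) = B z x - B z y"
  using B_add_left[of "x - y" y z] B_add_right[of z "x - y" y] by simp_all

lemma B_sum_left: "B (sum g A) z = (\<Sum>i\<in>A. B (g i) z)"
  by (induction A rule: infinite_finite_induct) (simp_all add: B_add_left)

lemma B_sum_right: "B z (sum g A) = (\<Sum>i\<in>A. B z (g i))"
  by (induction A rule: infinite_finite_induct) (simp_all add: B_add_right)

lemma B_dual: "B u \<in> dual scale"
  using symplectic by (simp add: dual_def symplectic_form_def)

lemma dual_linear:
  assumes "\<phi> \<in> dual scale"
  shows "\<phi> (x + y) = \<phi> x + \<phi> y" "\<phi> (scale c x) = c * \<phi> x" "\<phi> (sum g A) = (\<Sum>i\<in>A. \<phi> (g i))" "\<phi> 0 = 0"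
proof -
  show add: "\<phi> (x + y) = \<phi> x + \<phi> y" and scale: "\<phi> (scale c x) = c * \<phi> x" for x y c
    using assms by (auto simp: dual_def Vector_Spaces.linear_iff)
  show zero: "\<phi> 0 = 0" using scale[of 0 0] by simp
  show "\<phi> (sum g A) = (\<Sum>i\<in>A. \<phi> (g i))"
    by (induction A rule: infinite_finite_induct) (simp_all add: zero add)
qed

text \<open>The map \<open>u \<mapsto> B u\<close>, written in the coordinates of a basis, is an injective endomorphism of a
finite-dimensional space and hence surjective.\<close>

lemma dual_representation:
  assumes \<phi>: "\<phi> \<in> dual scale"
  shows "\<exists>u. \<phi> = B u"
proof -
  define g where "g u = (\<Sum>b\<in>Basis. scale (B u b) b)" for u
  have eqI: "\<phi> = \<psi>" if "\<phi> \<in> dual scale" "\<psi> \<in> dual scale" "\<And>b. b \<in> Basis \<Longrightarrow> \<phi> b = \<psi> b" for \<phi> \<psi>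
  proof
    fix x
    have "x \<in> span Basis" using span_Basis by simp
    then obtain c where "x = (\<Sum>b\<in>Basis. scale (c b) b)"
      using span_finite[OF finite_Basis] by auto
    then show "\<phi> x = \<psi> x" using that by (simp add: dual_linear)
  qed
  have lin: "Vector_Spaces.linear scale scale g"
    by (simp add: Vector_Spaces.linear_iff vector_space_axioms g_def B_add_left B_scale_left
        scale_left_distrib sum.distrib scale_sum_right)
  have "inj g"
  proof (rule injI)
    fix u v assume "g u = g v"
    then have "(\<Sum>b\<in>Basis. scale (B (u - v) b) b) = 0"
      by (simp add: g_def B_diff scale_left_diff_distrib sum_subtractf)
    then have "B (u - v) b = 0" if "b \<in> Basis" for b
      using independentD[OF independent_Basis finite_Basis order.refl, of "\<lambda>b. B (u - v) b" b] that by simp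
    then have "B (u - v) = B 0"
      by (intro eqI B_dual) simp
    then have "u - v = 0" using B_nondegenerate[of "u - v"] by simp
    then show "u = v" by simp
  qed
  then have "surj g" using linear_inj_imp_surj[OF lin] by blast
  then obtain u where u: "(\<Sum>b\<in>Basis. scale (\<phi> b) b) = g u" by (metis surjD)
  then have "(\<Sum>b\<in>Basis. scale (\<phi> b - B u b) b) = 0"
    by (simp add: g_def scale_left_diff_distrib sum_subtractf)
  then have "\<phi> b = B u b" if "b \<in> Basis" for b
    using independentD[OF independent_Basis finite_Basis order.refl, of "\<lambda>b. \<phi> b - B u b" b] that by simp
  then show ?thesis using eqI[OF \<phi> B_dual] by blast
qed

lemma has_dimension_UNIV: "has_dimension scale UNIV (vector_space.dim scale UNIV)"
  unfolding has_dimension_def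
  using finite_Basis independent_Basis span_Basis dim_UNIV by (intro exI[of _ Basis]) simp

lemma has_dimension_any: "subspace S \<Longrightarrow> has_dimension scale S (vector_space.dim scale S)"
  using has_dimension_subspace(1)[OF has_dimension_UNIV] by simp

text \<open>Sending \<open>u\<close> to the coefficients of \<open>B u\<close> on a basis of \<open>L\<close> gives an endomorphism \<open>g\<close> with kernel
\<open>L\<^sup>\<bottom> = L\<close>. Its image is \<open>L\<close> because every functional on \<open>L\<close> extends to the whole space and is then
represented by a vector.\<close>

lemma lagrangian_dimension:
  assumes L: "lagrangian scale B L"
  shows "vector_space.dim scale UNIV = 2 * vector_space.dim scale L"
proof -
  have sub: "subspace L" and perp: "L = {v. \<forall>w\<in>L. B v w = 0}"
    using L by (simp_all add: lagrangian_def)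
  define d where "d = vector_space.dim scale L"
  have dL: "has_dimension scale L d"
    unfolding d_def by (rule has_dimension_any[OF sub])
  then obtain A where A: "finite A" "independent A" "span A = L"
    by (auto simp: has_dimension_def)
  interpret endo: vector_space_pair scale scale ..
  interpret times: vector_space "(*) :: 'f \<Rightarrow> 'f \<Rightarrow> 'f" by (rule vector_space_times)
  interpret functional: vector_space_pair scale "(*) :: 'f \<Rightarrow> 'f \<Rightarrow> 'f" ..
  define g where "g u = (\<Sum>a\<in>A. scale (B u a) a)" for u
  have lin: "Vector_Spaces.linear scale scale g"
    by (simp add: Vector_Spaces.linear_iff vector_space_axioms g_def B_add_left B_scale_left
        scale_left_distrib sum.distrib scale_sum_right)
  have "{u \<in> UNIV. g u = 0} = L"
  proof
    show "{u \<in> UNIV. g u = 0} \<subseteq> L"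
    proof
      fix u assume "u \<in> {u \<in> UNIV. g u = 0}"
      then have *: "B u a = 0" if "a \<in> A" for a
        using independentD[OF A(2) A(1) order.refl, of "\<lambda>a. B u a" a] that by (simp add: g_def)
      have "B u w = 0" if "w \<in> L" for w
      proof -
        have "w \<in> span A" using that A by simp
        then obtain c where "w = (\<Sum>a\<in>A. scale (c a) a)"
          using span_finite[OF A(1)] by auto
        then show ?thesis by (simp add: B_sum_right B_scale_right *)
      qed
      then show "u \<in> L" using perp by blast
    qed
    show "L \<subseteq> {u \<in> UNIV. g u = 0}"
    proof
      fix u assume "u \<in> L"
      then have "B u a = 0" if "a \<in> A" for a
        using perp that A(3) span_superset[of A] by blast
      then show "u \<in> {u \<in> UNIV. g u = 0}" by (simp add: g_def)
    qed
  qed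
  moreover have "g ` UNIV = L"
  proof
    show "g ` UNIV \<subseteq> L"
      unfolding A(3)[symmetric]
      by (auto simp: g_def intro: span_sum span_scale span_base)
    show "L \<subseteq> g ` UNIV"
    proof
      fix y assume "y \<in> L"
      then have "y \<in> span A" using A by simp
      then obtain c where c: "y = (\<Sum>a\<in>A. scale (c a) a)"
        using span_finite[OF A(1)] by auto
      obtain \<phi> where \<phi>: "Vector_Spaces.linear scale (*) \<phi>" "\<forall>a\<in>A. \<phi> a = c a"
        using functional.linear_independent_extend[OF A(2)] by blast
      then obtain u where "\<phi> = B u" using dual_representation by (auto simp: dual_def)
      then have "g u = y" using \<phi> by (simp add: g_def c)
      then show "y \<in> g ` UNIV" by blast
    qed
  qed
  ultimately have *: "has_dimension scale UNIV (d + d)"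
    using endo.has_dimension_kernel_image[OF lin subspace_UNIV] dL by simp
  show ?thesis using has_dimensionD(2)[OF *] by (simp only: d_def mult_2)
qed

lemma has_dimension_dual:
  "has_dimension (\<lambda>c \<phi> v. c * \<phi> v) (dual scale) (vector_space.dim scale UNIV)"
proof -
  interpret func: vector_space "\<lambda>c (\<phi> :: 'v \<Rightarrow> 'f) v. c * \<phi> v"
    by (rule vector_space_pointwise[OF vector_space_times])
  interpret vector_space_pair scale "\<lambda>c (\<phi> :: 'v \<Rightarrow> 'f) v. c * \<phi> v" ..
  have "Vector_Spaces.linear scale (\<lambda>c \<phi> v. c * \<phi> v) B"
    by (simp add: Vector_Spaces.linear_iff vector_space_axioms func.vector_space_axioms
        fun_eq_iff B_add_left B_scale_left)
  moreover have "B ` UNIV = dual scale" using B_dual dual_representation by blast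
  moreover have "inj B"
  proof (rule injI)
    fix x y assume "B x = B y"
    then have "B (x - y) w = 0" for w by (simp add: B_diff)
    then show "x = y" using B_nondegenerate[of "x - y"] by simp
  qed
  ultimately show ?thesis using has_dimension_inj_image[OF _ has_dimension_UNIV, of B] by simp
qed

end

text \<open>Induction on \<open>n\<close>: the last entry projects onto \<open>L n\<close>, and the kernel consists of the shorter families.\<close>

lemma has_dimension_family_sum:
  fixes scale :: "'f::field \<Rightarrow> 'v::ab_group_add \<Rightarrow> 'v"
  assumes V: "vector_space scale" and "\<And>i. i \<in> {1..n} \<Longrightarrow> has_dimension scale (L i) (d i)"
  shows "has_dimension (\<lambda>c a i. scale c (a i)) (family_sum n L) (\<Sum>i=1..n. d i)"
  using assms(2)
proof (induction n)
  interpret V: vector_space scale by fact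
  interpret F: vector_space "\<lambda>c (a :: nat \<Rightarrow> 'v) i. scale c (a i)"
    by (rule vector_space_pointwise[OF V])
  interpret vector_space_pair "\<lambda>c (a :: nat \<Rightarrow> 'v) i. scale c (a i)" scale ..
  {
    case 0
    have "family_sum 0 L = {0}" by (auto simp: family_sum_def)
    then show ?case
      unfolding has_dimension_def
      by (intro exI[of _ "{}"]) (simp add: F.span_empty F.independent_empty)
  next
    case (Suc n)
    let ?S = "family_sum (Suc n) L"
    have sub: "V.subspace (L i)" if "i \<in> {1..Suc n}" for i
      using Suc.prems[OF that] V.has_dimensionD(1) by blast
    have S: "F.subspace ?S"
      using V.subspace_0[OF sub] V.subspace_add[OF sub] V.subspace_scale[OF sub]
      by (auto simp: F.subspace_def family_sum_def)
    have lin: "Vector_Spaces.linear (\<lambda>c a i. scale c (a i)) scale (\<lambda>a :: nat \<Rightarrow> 'v. a (Suc n))"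
      by (simp add: Vector_Spaces.linear_iff V.vector_space_axioms F.vector_space_axioms)
    have "{a \<in> ?S. a (Suc n) = 0} = family_sum n L"
      using V.subspace_0[OF sub[of "Suc n"]]
      by (auto simp: family_sum_def atLeastAtMostSuc_conv) (metis Suc_leI antisym_conv2 not_less)
    moreover have "(\<lambda>a. a (Suc n)) ` ?S = L (Suc n)"
    proof
      show "L (Suc n) \<subseteq> (\<lambda>a. a (Suc n)) ` ?S"
      proof
        fix x assume "x \<in> L (Suc n)"
        then have "(\<lambda>i. if i = Suc n then x else 0) \<in> ?S"
          using V.subspace_0[OF sub] by (auto simp: family_sum_def)
        then show "x \<in> (\<lambda>a. a (Suc n)) ` ?S" by (rule rev_image_eqI) simp
      qed
    qed (auto simp: family_sum_def)
    ultimately show ?case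
      using has_dimension_kernel_image[OF lin S, of "\<Sum>i=1..n. d i" "d (Suc n)"] Suc
      by simp
  }
qed

section \<open>The kernel of the form on \<open>V\<^sup>* \<oplus> \<Oplus> l\<^sub>i\<close>\<close>

lemma sum_triangle_swap:
  "(\<Sum>i=1..n. \<Sum>j=1..i. g i j) = (\<Sum>j=1..n. \<Sum>i=j..n. (g i j :: 'a::comm_monoid_add))" for n :: nat
  by (induction n) (simp_all add: sum.distrib ac_simps)

locale lagrangian_cycle = symplectic_space scale Basis B
  for scale :: "'f::field \<Rightarrow> 'v::ab_group_add \<Rightarrow> 'v" and Basis and B +
  fixes n :: nat and l :: "nat \<Rightarrow> 'v set"
  assumes char: "CHAR('f) \<noteq> 2" and n: "n \<ge> 1"
    and lagrangians: "\<And>i. i \<in> {1..n} \<Longrightarrow> lagrangian scale B (l i)"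
begin

lemma l_subspace: "i \<in> {1..n} \<Longrightarrow> subspace (l i)"
  using lagrangians by (simp add: lagrangian_def)

lemma l_iff: "i \<in> {1..n} \<Longrightarrow> x \<in> l i \<longleftrightarrow> (\<forall>w\<in>l i. B x w = 0)"
  using lagrangians unfolding lagrangian_def by blast

lemma l_isotropic: "i \<in> {1..n} \<Longrightarrow> x \<in> l i \<Longrightarrow> y \<in> l i \<Longrightarrow> B x y = 0"
  using l_iff by blast

text \<open>The anti-derivative of a family with sum zero that vanishes at the edge \<open>{n, 1}\<close>.\<close>

definition partial_sum :: "(nat \<Rightarrow> 'v) \<Rightarrow> nat \<Rightarrow> 'v" where
  "partial_sum a i = (\<Sum>j=1..i. a j)"

text \<open>The triangular double sum is not symmetric in its arguments, but when the \<open>a i\<close> add up to zero the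
tail sums are the negatives of the partial sums, and both halves give the same contribution. The
diagonal terms vanish because \<open>a i\<close> and \<open>b i\<close> lie in the same Lagrangian.\<close>

lemma qt_form_sum_zero:
  assumes dual: "\<phi> \<in> dual scale" "\<psi> \<in> dual scale"
    and a: "a \<in> family_sum n l" and b: "b \<in> family_sum n l" and sum_zero: "(\<Sum>i=1..n. a i) = 0"
  shows "qt_form B n (\<phi>, a) (\<psi>, b) = (\<Sum>i=1..n. \<phi> (b i) - B (partial_sum a i) (b i))"
proof -
  have "(\<Sum>i=1..n. \<psi> (a i)) = 0"
    using dual_linear(3,4)[OF dual(2)] sum_zero by metis
  moreover have "(\<Sum>i=1..n. \<Sum>j=1..i. B (b i) (a j)) = - (\<Sum>i=1..n. B (partial_sum a i) (b i))"
    by (simp add: partial_sum_def B_skew[of "b _"] B_sum_left sum_negf)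
  moreover have "(\<Sum>i=1..n. \<Sum>j=1..i. B (a i) (b j)) = - (\<Sum>i=1..n. B (partial_sum a i) (b i))"
  proof -
    have "(\<Sum>i=j..n. B (a i) (b j)) = - B (partial_sum a j) (b j)" if j: "j \<in> {1..n}" for j
    proof -
      have "(\<Sum>i=1..j. a i) + (\<Sum>i=j..n. a i) = (\<Sum>i=1..n. a i) + a j"
      proof -
        have "{1..n} = {1..j} \<union> {Suc j..n}" "{j..n} = insert j {Suc j..n}" using j by auto
        then show ?thesis
          by (simp add: sum.union_disjoint ac_simps)
      qed
      then have "(\<Sum>i=j..n. a i) = a j - partial_sum a j"
        using sum_zero by (simp add: partial_sum_def eq_diff_eq add.commute)
      then have "B (\<Sum>i=j..n. a i) (b j) = B (a j - partial_sum a j) (b j)" by simp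
      also have "\<dots> = - B (partial_sum a j) (b j)"
        using a b j l_isotropic[of j] by (simp add: B_diff family_sum_def)
      finally show ?thesis by (simp add: B_sum_left)
    qed
    then have "(\<Sum>j=1..n. \<Sum>i=j..n. B (a i) (b j)) = (\<Sum>j=1..n. - B (partial_sum a j) (b j))"
      by (intro sum.cong) auto
    then show ?thesis by (simp only: sum_triangle_swap sum_negf)
  qed
  ultimately show ?thesis
    using two_neq_zero[OF char]
    by (simp add: qt_form_eq[OF symplectic dual char] sum.distrib sum_subtractf field_simps)
qed

lemma boundary_sum_zero: "(\<Sum>i=1..n. boundary n e i) = 0"
  and partial_sum_boundary: "i \<in> {1..n} \<Longrightarrow> partial_sum (boundary n e) i = e i - e n"
proof -
  have *: "partial_sum (boundary n e) i = e i - e n" if "i \<ge> 1" "i \<le> n" for i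
    using that
  proof (induction i rule: dec_induct)
    case base
    then show ?case by (simp add: partial_sum_def boundary_def cyc_pred_def)
  next
    case (step i)
    then show ?case by (simp add: partial_sum_def boundary_def cyc_pred_def)
  qed
  then show "i \<in> {1..n} \<Longrightarrow> partial_sum (boundary n e) i = e i - e n" by simp
  show "(\<Sum>i=1..n. boundary n e i) = 0"
    using *[of n] n by (simp add: partial_sum_def)
qed

lemma cyc_simps:
  assumes "i \<in> {1..n}"
  shows "cyc_pred n i \<in> {1..n}" "cyc_succ n i \<in> {1..n}" "cyc_succ n (cyc_pred n i) = i"
  using assms by (auto simp: cyc_pred_def cyc_succ_def)

lemma boundary_tilde_in_Kt:
  assumes "e \<in> edge_sum n l"
  shows "boundary_tilde B n e \<in> Kt_set scale n l"
proof -
  have e: "e i \<in> l i \<inter> l (cyc_succ n i)" if "i \<in> {1..n}" for i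
    using assms that by (simp add: edge_sum_def family_sum_def)
  have "e i \<in> l i" "e (cyc_pred n i) \<in> l i" if "i \<in> {1..n}" for i
    using e[OF that] e[OF cyc_simps(1)[OF that]] cyc_simps(3)[OF that] by auto
  then have "boundary n e \<in> family_sum n l"
    using l_subspace by (auto simp: family_sum_def boundary_def subspace_diff)
  moreover have "- Phi_minus_1 B n e \<in> dual scale"
  proof -
    have "- Phi_minus_1 B n e = B (- e n)" by (auto simp: Phi_minus_1_def B_minus)
    then show ?thesis by (simp add: B_dual)
  qed
  ultimately show ?thesis by (simp add: Kt_set_def boundary_tilde_def)
qed

text \<open>Orthogonality of \<open>(\<phi>, a)\<close> to the functionals forces the sum of the \<open>a i\<close> to vanish. If \<open>\<phi> = B u\<close>,
orthogonality to a vector of \<open>l i\<close> then says that \<open>e i = partial_sum a i - u\<close> is orthogonal to \<open>l i\<close>,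
that is, lies in \<open>l i\<close>. Since consecutive \<open>e i\<close> differ by \<open>a (i + 1)\<close>, which lies in \<open>l (i + 1)\<close>, each
\<open>e i\<close> lies in two neighbouring Lagrangians, and its boundary is \<open>a\<close>.\<close>

theorem form_kernel_Kt:
  "form_kernel (Kt_space scale B n l) = boundary_tilde B n ` edge_sum n l"
proof
  show "boundary_tilde B n ` edge_sum n l \<subseteq> form_kernel (Kt_space scale B n l)"
  proof
    fix x assume "x \<in> boundary_tilde B n ` edge_sum n l"
    then obtain e where e: "e \<in> edge_sum n l" "x = boundary_tilde B n e" by blast
    note K = boundary_tilde_in_Kt[OF e(1)]
    have "qt_form B n x y = 0" if hy: "y \<in> Kt_set scale n l" for y
    proof -
      obtain \<psi> b where y: "y = (\<psi>, b)" "\<psi> \<in> dual scale" "b \<in> family_sum n l"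
        using hy by (auto simp: Kt_set_def)
      have "qt_form B n x y
          = (\<Sum>i=1..n. (- Phi_minus_1 B n e) (b i) - B (partial_sum (boundary n e) i) (b i))"
        unfolding e(2) y(1) boundary_tilde_def
        by (rule qt_form_sum_zero)
          (use K y boundary_sum_zero in \<open>auto simp: Kt_set_def boundary_tilde_def\<close>)
      also have "\<dots> = (\<Sum>i=1..n. 0)"
      proof (rule sum.cong)
        fix i assume i: "i \<in> {1..n}"
        have "B (e i) (b i) = 0"
          using e(1) y(3) i l_isotropic[OF i] by (auto simp: edge_sum_def family_sum_def)
        then show "(- Phi_minus_1 B n e) (b i) - B (partial_sum (boundary n e) i) (b i) = 0"
          using i by (simp add: partial_sum_boundary Phi_minus_1_def B_diff)
      qed simp
      finally show ?thesis by simp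
    qed
    then show "x \<in> form_kernel (Kt_space scale B n l)"
      using K e by (simp add: orthogonal_def Kt_space_def)
  qed
  show "form_kernel (Kt_space scale B n l) \<subseteq> boundary_tilde B n ` edge_sum n l"
  proof
    fix x assume "x \<in> form_kernel (Kt_space scale B n l)"
    then have x: "x \<in> Kt_set scale n l" and orth: "\<And>y. y \<in> Kt_set scale n l \<Longrightarrow> qt_form B n x y = 0"
      by (auto simp: orthogonal_def Kt_space_def)
    obtain \<phi> a where xa: "x = (\<phi>, a)" and \<phi>: "\<phi> \<in> dual scale" and a: "a \<in> family_sum n l"
      using x by (auto simp: Kt_set_def)
    have zero_dual: "0 \<in> dual scale" 
    using vector_space_axioms vector_space_times by (simp add: dual_def Vector_Spaces.linear_iff)
    have zero_family: "0 \<in> family_sum n l"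
      using l_subspace by (auto simp: family_sum_def subspace_0)
    have sum_zero: "(\<Sum>i=1..n. a i) = 0"
    proof -
      have "B u (\<Sum>i=1..n. a i) = 0" for u
        using orth[of "(B u, 0)"] zero_family B_dual
        by (simp add: Kt_set_def xa qt_form_eq[OF symplectic \<phi> B_dual char] B_sum_right dual_linear(4)[OF \<phi>])
      then show ?thesis
        using B_nondegenerate B_skew by (metis neg_equal_0_iff_equal)
    qed
    obtain u where u: "\<phi> = B u" using dual_representation[OF \<phi>] by blast
    have mem: "partial_sum a i - u \<in> l i" if i: "i \<in> {1..n}" for i
      unfolding l_iff[OF i]
    proof
      fix w assume w: "w \<in> l i"
      define b where "b = (\<lambda>j. if j = i then w else 0)"
      have b: "b \<in> family_sum n l"
        using w i l_subspace by (auto simp: b_def family_sum_def subspace_0)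
      have "0 = (\<Sum>j=1..n. \<phi> (b j) - B (partial_sum a j) (b j))"
        using orth[of "(0, b)"] zero_dual b
        by (simp add: Kt_set_def xa qt_form_sum_zero[OF \<phi> zero_dual a b sum_zero])
      also have "\<dots> = (\<Sum>j=1..n. if j = i then B u w - B (partial_sum a i) w else 0)"
        by (rule sum.cong) (auto simp: b_def u)
      also have "\<dots> = B u w - B (partial_sum a i) w" using i by simp
      finally show "B (partial_sum a i - u) w = 0" by (simp add: B_diff)
    qed
    define e where "e i = (if i \<in> {1..n} then partial_sum a i - u else 0)" for i
    have sn: "partial_sum a n = 0" using sum_zero by (simp add: partial_sum_def)
    have s1: "partial_sum a 1 = a 1" by (simp add: partial_sum_def)
    have step: "partial_sum a (Suc i) = partial_sum a i + a (Suc i)" for i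
      by (simp add: partial_sum_def)
    have a_mem: "a i \<in> l i" if "i \<in> {1..n}" for i using a that by (simp add: family_sum_def)
    have "e i \<in> l i \<inter> l (cyc_succ n i)" if i: "i \<in> {1..n}" for i
    proof
      show "e i \<in> l i" using mem[OF i] i by (simp add: e_def)
      let ?j = "cyc_succ n i"
      have j: "?j \<in> {1..n}" using cyc_simps(2)[OF i] .
      have "partial_sum a ?j - a ?j = partial_sum a i"
        using sn s1 step[of i] by (auto simp: cyc_succ_def)
      then have "e i = (partial_sum a ?j - u) - a ?j" using i by (simp add: e_def algebra_simps)
      then show "e i \<in> l ?j"
        using subspace_diff[OF l_subspace[OF j] mem[OF j] a_mem[OF j]] by simp
    qed
    then have e_mem: "e \<in> edge_sum n l" by (auto simp: edge_sum_def family_sum_def e_def)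
    have "boundary n e = a"
    proof
      fix i
      show "boundary n e i = a i"
      proof (cases "i \<in> {1..n}")
        case False
        then show ?thesis using a by (auto simp: boundary_def family_sum_def)
      next
        case True
        show ?thesis
        proof (cases "i = 1")
          case i1: True
          show ?thesis using True n sn s1 by (simp add: i1 boundary_def cyc_pred_def e_def)
        next
          case False
          then obtain k where "i = Suc k" "k \<in> {1..n}" using True by (cases i) auto
          then show ?thesis using True False step[of k]
            by (simp add: boundary_def cyc_pred_def e_def)
        qed
      qed
    qed
    moreover have "- Phi_minus_1 B n e = \<phi>"
      using n sn by (simp add: Phi_minus_1_def e_def u B_minus fun_eq_iff)
    ultimately show "x \<in> boundary_tilde B n ` edge_sum n l"
      using e_mem by (auto simp: xa boundary_tilde_def)
  qed
qed

text \<open>The functional determines \<open>e n\<close>, and the boundary determines all differences \<open>e i - e n\<close>.\<close>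

lemma boundary_tilde_inj: "inj_on (boundary_tilde B n) (edge_sum n l)"
proof (rule inj_onI)
  fix e e' assume e: "e \<in> edge_sum n l" "e' \<in> edge_sum n l"
    and eq: "boundary_tilde B n e = boundary_tilde B n e'"
  have bd: "boundary n e = boundary n e'" and "B (e n) = B (e' n)"
    using eq by (auto simp: boundary_tilde_def Phi_minus_1_def)
  then have "B (e n - e' n) w = 0" for w by (simp add: B_diff)
  then have en: "e n = e' n" using B_nondegenerate[of "e n - e' n"] by simp
  have "e i = e' i" if "i \<in> {1..n}" for i
    using partial_sum_boundary[OF that, of e] partial_sum_boundary[OF that, of e'] bd en by simp
  moreover have "e i = e' i" if "i \<notin> {1..n}" for i
    using e that by (auto simp: edge_sum_def family_sum_def)
  ultimately show "e = e'" by blast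
qed


lemma vector_space_Kt: "vector_space (Kt_scale scale)"
  by unfold_locales
    (auto simp: Kt_scale_def fun_eq_iff scale_left_distrib scale_right_distrib algebra_simps)

lemma family_subspace:
  assumes "\<And>i. i \<in> {1..n} \<Longrightarrow> subspace (L i)"
  shows "module.subspace (\<lambda>c a i. scale c (a i)) (family_sum n L)"
proof -
  interpret F: vector_space "\<lambda>c (a :: nat \<Rightarrow> 'v) i. scale c (a i)"
    by (rule vector_space_pointwise[OF vector_space_axioms])
  show ?thesis
    using subspace_0[OF assms] subspace_add[OF assms] subspace_scale[OF assms]
    by (auto simp: F.subspace_def family_sum_def)
qed

lemma dual_closed:
  "0 \<in> dual scale" "\<phi> \<in> dual scale \<Longrightarrow> \<psi> \<in> dual scale \<Longrightarrow> \<phi> + \<psi> \<in> dual scale"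
  "\<phi> \<in> dual scale \<Longrightarrow> (\<lambda>v. c * \<phi> v) \<in> dual scale"
  using vector_space_axioms vector_space_times
  by (auto simp: dual_def Vector_Spaces.linear_iff algebra_simps)

lemma dual_times_subspace:
  assumes "module.subspace (\<lambda>c a i. scale c (a i)) S"
  shows "module.subspace (Kt_scale scale) (dual scale \<times> S)"
proof -
  interpret F: vector_space "\<lambda>c (a :: nat \<Rightarrow> 'v) i. scale c (a i)"
    by (rule vector_space_pointwise[OF vector_space_axioms])
  interpret Kt: vector_space "Kt_scale scale" by (rule vector_space_Kt)
  show ?thesis
    using assms dual_closed
    by (auto simp: Kt.subspace_def F.subspace_def Kt_scale_def zero_prod_def)
qed

lemma Kt_symmetric_form: "symmetric_form (Kt_scale scale) (Kt_set scale n l) (qt_form B n)"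
proof -
  have "module.subspace (Kt_scale scale) (Kt_set scale n l)"
    unfolding Kt_set_def by (intro dual_times_subspace family_subspace l_subspace)
  moreover have "symmetric_bilinear_on (space_on (Kt_scale scale) (Kt_set scale n l) (qt_form B n))"
    using qt_form_properties(2-4)[OF symplectic char] by (simp add: symmetric_bilinear_on_def)
  ultimately show ?thesis
    using vector_space_Kt by (simp add: symmetric_form_def symmetric_form_axioms_def)
qed

lemma has_dimension_dual_times_zero:
  "has_dimension (Kt_scale scale) (dual scale \<times> {0}) (vector_space.dim scale UNIV)"
proof -
  interpret func: vector_space "\<lambda>c (\<phi> :: 'v \<Rightarrow> 'f) v. c * \<phi> v"
    by (rule vector_space_pointwise[OF vector_space_times])
  interpret Kt: vector_space "Kt_scale scale" by (rule vector_space_Kt)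
  interpret vector_space_pair "\<lambda>c (\<phi> :: 'v \<Rightarrow> 'f) v. c * \<phi> v" "Kt_scale scale" ..
  have "Vector_Spaces.linear (\<lambda>c \<phi> v. c * \<phi> v) (Kt_scale scale) (\<lambda>\<phi>. (\<phi>, 0))"
    by (simp add: Vector_Spaces.linear_iff func.vector_space_axioms Kt.vector_space_axioms
        Kt_scale_def fun_eq_iff)
  moreover have "(\<lambda>\<phi>. (\<phi>, 0 :: nat \<Rightarrow> 'v)) ` dual scale = dual scale \<times> {0}" by auto
  ultimately show ?thesis
    using has_dimension_inj_image[OF _ has_dimension_dual, of "\<lambda>\<phi>. (\<phi>, 0)"]
    by (simp add: inj_on_def)
qed

lemma has_dimension_Kt:
  "has_dimension (Kt_scale scale) (Kt_set scale n l)
    (vector_space.dim scale UNIV + (\<Sum>i=1..n. vector_space.dim scale (l i)))"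
proof -
  interpret F: vector_space "\<lambda>c (a :: nat \<Rightarrow> 'v) i. scale c (a i)"
    by (rule vector_space_pointwise[OF vector_space_axioms])
  interpret Kt: vector_space "Kt_scale scale" by (rule vector_space_Kt)
  interpret vector_space_pair "Kt_scale scale" "\<lambda>c (a :: nat \<Rightarrow> 'v) i. scale c (a i)" ..
  have zero: "0 \<in> dual scale" "0 \<in> family_sum n l"
    using dual_closed l_subspace by (auto simp: family_sum_def subspace_0)
  have lin: "Vector_Spaces.linear (Kt_scale scale) (\<lambda>c a i. scale c (a i)) snd"
    by (simp add: Vector_Spaces.linear_iff F.vector_space_axioms Kt.vector_space_axioms
        Kt_scale_def split_def)
  have sub: "Kt.subspace (Kt_set scale n l)"
    using Kt_symmetric_form by (simp add: symmetric_form_def symmetric_form_axioms_def)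
  have "{x \<in> Kt_set scale n l. snd x = 0} = dual scale \<times> {0}"
    using zero by (auto simp: Kt_set_def)
  moreover have "snd ` Kt_set scale n l = family_sum n l"
    using zero by (auto simp: Kt_set_def image_iff)
  ultimately show ?thesis
    using has_dimension_kernel_image[OF lin sub] has_dimension_dual_times_zero
      has_dimension_family_sum[OF vector_space_axioms has_dimension_any[OF l_subspace]] by simp
qed

lemma has_dimension_kernel:
  "has_dimension (Kt_scale scale) (boundary_tilde B n ` edge_sum n l)
    (\<Sum>i=1..n. vector_space.dim scale (l i \<inter> l (cyc_succ n i)))"
proof -
  interpret F: vector_space "\<lambda>c (a :: nat \<Rightarrow> 'v) i. scale c (a i)"
    by (rule vector_space_pointwise[OF vector_space_axioms])
  interpret Kt: vector_space "Kt_scale scale" by (rule vector_space_Kt)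
  interpret vector_space_pair "\<lambda>c (a :: nat \<Rightarrow> 'v) i. scale c (a i)" "Kt_scale scale" ..
  have "has_dimension (\<lambda>c a i. scale c (a i)) (edge_sum n l)
      (\<Sum>i=1..n. vector_space.dim scale (l i \<inter> l (cyc_succ n i)))"
    unfolding edge_sum_def
    by (intro has_dimension_family_sum vector_space_axioms has_dimension_any subspace_inter
        l_subspace cyc_simps)
  moreover have "Vector_Spaces.linear (\<lambda>c a i. scale c (a i)) (Kt_scale scale) (boundary_tilde B n)"
    by (simp add: Vector_Spaces.linear_iff F.vector_space_axioms Kt.vector_space_axioms
        boundary_tilde_def boundary_def Phi_minus_1_def Kt_scale_def fun_eq_iff
        B_add_left B_scale_left scale_right_diff_distrib)
  ultimately show ?thesis
    using has_dimension_inj_image boundary_tilde_inj by blast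
qed

text \<open>On the orthogonal complement of the functionals the form only sees the second components, where it
is the form of \<open>K\<close>.\<close>

lemma q_form_eq_qt_form:
  assumes "\<phi> \<in> dual scale" "\<psi> \<in> dual scale" "v \<in> K_set n l" "w \<in> K_set n l"
  shows "qt_form B n (\<phi>, v) (\<psi>, w) = q_form B n v w"
proof -
  have v: "v \<in> family_sum n l" "(\<Sum>i=1..n. v i) = 0" and w: "w \<in> family_sum n l" "(\<Sum>i=1..n. w i) = 0"
    using assms by (auto simp: K_set_def)
  have "anti_derivative n w (partial_sum w)"
    unfolding anti_derivative_def
  proof
    fix i assume "i \<in> {1..n}"
    then obtain k where i: "i = Suc k" by (cases i) auto
    show "partial_sum w i - partial_sum w (cyc_pred n i) = w i"
      using w by (cases k) (simp_all add: i cyc_pred_def partial_sum_def)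
  qed
  then have "q_form B n v w = (\<Sum>i=1..n. B (v i) (partial_sum w i))"
    by (rule q_form_eq[OF symplectic v(2)])
  moreover have "qt_form B n (\<psi>, w) (\<phi>, v) = (\<Sum>i=1..n. \<psi> (v i) - B (partial_sum w i) (v i))"
    by (rule qt_form_sum_zero) (use assms v w in auto)
  moreover have "(\<Sum>i=1..n. \<psi> (v i)) = 0"
    using dual_linear(3,4)[OF assms(2)] v(2) by metis
  moreover have "qt_form B n (\<phi>, v) (\<psi>, w) = qt_form B n (\<psi>, w) (\<phi>, v)"
    by (rule qt_form_properties(2)[OF symplectic char])
      (use assms v w in \<open>auto simp: Kt_set_def\<close>)
  ultimately show ?thesis
    by (simp add: sum_subtractf B_skew[of "v _"] sum_negf)
qed

lemma orthogonal_dual: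
  "orthogonal (Kt_space scale B n l) (dual scale \<times> {0}) = dual scale \<times> K_set n l"
proof -
  have form: "qt_form B n (\<phi>, a) (\<psi>, 0) = \<psi> (\<Sum>i=1..n. a i)"
    if "\<phi> \<in> dual scale" "\<psi> \<in> dual scale" for \<phi> \<psi> and a :: "nat \<Rightarrow> 'v"
    using that by (simp add: qt_form_eq[OF symplectic that char] dual_linear)
  have "a = 0" if "\<And>\<psi>. \<psi> \<in> dual scale \<Longrightarrow> \<psi> a = 0" for a
    using B_nondegenerate[of a] that[OF B_dual] B_skew by (metis neg_equal_0_iff_equal)
  then show ?thesis
    by (auto simp: orthogonal_def Kt_space_def Kt_set_def K_set_def form dual_linear(4))
qed

lemma isotropic_dual: "isotropic_subspace (Kt_space scale B n l) (dual scale \<times> {0})"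
proof -
  interpret Kt: symmetric_form "Kt_scale scale" "Kt_set scale n l" "qt_form B n"
    by (rule Kt_symmetric_form)
  have sub: "Kt.subspace (dual scale \<times> {0})"
    using Kt.has_dimensionD(1)[OF has_dimension_dual_times_zero] .
  have V: "vectorspace class_ring (Kt_space scale B n l)"
    unfolding Kt_space_def by (rule vectorspace_space_on[OF vector_space_Kt Kt.subspace_U])
  then have "Module.module class_ring (Kt_space scale B n l)" by (simp add: vectorspace_def)
  moreover have "dual scale \<times> {0} \<subseteq> Kt_set scale n l"
    using l_subspace by (auto simp: Kt_set_def family_sum_def subspace_0)
  ultimately have "submodule class_ring (dual scale \<times> {0}) (Kt_space scale B n l)"
    using sub unfolding submodule_def Kt.subspace_def Kt_space_def by simp
  moreover have "qt_form B n (\<phi>, 0) (\<psi>, 0) = 0" if "\<phi> \<in> dual scale" "\<psi> \<in> dual scale" for \<phi> \<psi>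
    by (simp add: qt_form_eq[OF symplectic that char] dual_linear(4)[OF that(1)] dual_linear(4)[OF that(2)])
  ultimately show ?thesis
    using V by (auto simp: isotropic_subspace_def VectorSpace.subspace_def Kt_space_def)
qed

end

section \<open>Comparison of the two spaces of a cycle of Lagrangians\<close>

context lagrangian_cycle
begin

lemma Kt_space_facts:
  shows "vectorspace class_ring (Kt_space scale B n l)"
    and "symmetric_bilinear_on (Kt_space scale B n l)"
    and "vectorspace.fin_dim class_ring (Kt_space scale B n l)"
    and "isometric_cover (Kt_space scale B n l) (Tt_space scale B n l)
          (\<lambda>x. form_kernel (Kt_space scale B n l) +>\<^bsub>Kt_space scale B n l\<^esub> x)"
    and "quadratic_space (Tt_space scale B n l)"
proof -
  let ?M = "Kt_space scale B n l"
  interpret Kt: symmetric_form "Kt_scale scale" "Kt_set scale n l" "qt_form B n"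
    by (rule Kt_symmetric_form)
  show V: "vectorspace class_ring ?M"
    unfolding Kt_space_def by (rule vectorspace_space_on[OF vector_space_Kt Kt.subspace_U])
  show sym: "symmetric_bilinear_on ?M"
    using Kt.symmetric_bilinear by (simp add: Kt_space_def)
  show fin: "vectorspace.fin_dim class_ring ?M"
    unfolding Kt_space_def using Kt.space_on_dimension[OF has_dimension_Kt] by auto
  show "isometric_cover ?M (Tt_space scale B n l) (\<lambda>x. form_kernel ?M +>\<^bsub>?M\<^esub> x)"
    and "quadratic_space (Tt_space scale B n l)"
    unfolding Tt_space_def by (rule quadratic_space_quotient_kernel[OF V sym fin])+
qed

text \<open>Rank-nullity for the projection of \<open>V\<^sup>* \<oplus> \<Oplus> l\<^sub>i\<close> onto its quotient, whose kernel is the injective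
image of the sum of the intersections.\<close>

theorem dim_Tt:
  "real (vectorspace.dim class_ring (Tt_space scale B n l)) =
     (real n + 2) * (real (vector_space.dim scale UNIV) / 2)
     - (\<Sum>i=1..n. real (vector_space.dim scale (l i \<inter> l (cyc_succ n i))))"
proof -
  let ?M = "Kt_space scale B n l" and ?T = "Tt_space scale B n l"
  let ?\<pi> = "\<lambda>x. form_kernel ?M +>\<^bsub>?M\<^esub> x"
  interpret Kt: symmetric_form "Kt_scale scale" "Kt_set scale n l" "qt_form B n"
    by (rule Kt_symmetric_form)
  note V = Kt_space_facts(1) and sym = Kt_space_facts(2) and fin = Kt_space_facts(3)
    and cover = Kt_space_facts(4)
  have dimM: "vectorspace.dim class_ring ?M
      = vector_space.dim scale UNIV + (\<Sum>i=1..n. vector_space.dim scale (l i))"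
    unfolding Kt_space_def using Kt.space_on_dimension[OF has_dimension_Kt] by auto
  from cover interpret \<pi>: linear_map class_ring ?M ?T ?\<pi>
    by (simp add: isometric_cover_def)
  note facts = coset_facts[OF V orthogonal_is_subspace[OF V sym order.refl]]
  have "\<pi>.im = carrier ?T"
    using cover unfolding \<pi>.im_def isometric_cover_def by blast
  then have im: "?T\<lparr>carrier := \<pi>.im\<rparr> = ?T" by simp
  have zero: "\<zero>\<^bsub>?T\<^esub> = form_kernel ?M" by (simp add: Tt_space_def)
  have "\<pi>.ker = form_kernel ?M"
    unfolding \<pi>.ker_def zero using facts(3,4) by (auto simp: orthogonal_def)
  then have "vectorspace.dim class_ring (?M\<lparr>carrier := \<pi>.ker\<rparr>)
      = (\<Sum>i=1..n. vector_space.dim scale (l i \<inter> l (cyc_succ n i)))"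
    unfolding form_kernel_Kt using Kt.space_on_dimension(2)[OF has_dimension_kernel]
    by (simp add: Kt_space_def)
  then have "vectorspace.dim class_ring ?T + (\<Sum>i=1..n. vector_space.dim scale (l i \<inter> l (cyc_succ n i)))
      = vector_space.dim scale UNIV + (\<Sum>i=1..n. vector_space.dim scale (l i))"
    using \<pi>.rank_nullity[OF fin] unfolding im dimM by simp
  then have "real (vectorspace.dim class_ring ?T) + (\<Sum>i=1..n. real (vector_space.dim scale (l i \<inter> l (cyc_succ n i))))
      = real (vector_space.dim scale UNIV) + (\<Sum>i=1..n. real (vector_space.dim scale (l i)))"
    by (simp only: of_nat_add[symmetric] of_nat_sum[symmetric])
  moreover have "real (vector_space.dim scale (l i)) = real (vector_space.dim scale UNIV) / 2"
    if "i \<in> {1..n}" for i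
    using lagrangian_dimension[OF lagrangians[OF that]] by linarith
  then have "(\<Sum>i=1..n. real (vector_space.dim scale (l i))) = (\<Sum>i=1..n. real (vector_space.dim scale UNIV) / 2)"
    by (rule sum.cong[OF refl])
  ultimately show ?thesis by (simp add: algebra_simps)
qed

text \<open>The space \<open>P = V\<^sup>* \<oplus> K\<close> is the orthogonal complement of \<open>V\<^sup>*\<close>. It surjects onto \<open>T\<close> by forgetting
the functional and onto the subquotient by passing to cosets twice; adding a hyperbolic space, it
surjects onto \<open>T\<close> plus that hyperbolic space and, by \<open>hyperbolic_cover\<close>, also onto the space
\<open>Tt_space\<close>. All these targets are non-degenerate, so the two surjections in each pair have isometric
targets.\<close>

theorem T_subquotient_of_Tt:
  shows "quadratic_space (T_space scale B n l)"
    and "quadratic_space (Tt_space scale B n l)"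
    and "isotropic_subspace (Tt_space scale B n l) (dual_image scale B n l)"
    and "isometric (T_space scale B n l)
        (quadratic_subquotient (Tt_space scale B n l) (dual_image scale B n l))"
    and "witt_equivalent (T_space scale B n l) (Tt_space scale B n l)"
proof -
  let ?M = "Kt_space scale B n l" and ?K = "K_space scale B n l"
    and ?T = "T_space scale B n l" and ?Tt = "Tt_space scale B n l"
    and ?I = "dual_image scale B n l"
  let ?P = "space_on (Kt_scale scale) (dual scale \<times> K_set n l) (qt_form B n)"
  let ?\<pi> = "\<lambda>x. form_kernel ?M +>\<^bsub>?M\<^esub> x" and ?\<kappa> = "\<lambda>x. form_kernel ?K +>\<^bsub>?K\<^esub> x"
  interpret Kt: symmetric_form "Kt_scale scale" "Kt_set scale n l" "qt_form B n"
    by (rule Kt_symmetric_form)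
  note V = Kt_space_facts(1) and sym = Kt_space_facts(2) and \<pi> = Kt_space_facts(4)
    and Tt = Kt_space_facts(5)
  show "quadratic_space ?Tt" by (rule Tt)

  have P_eq: "orthogonal (space_on (Kt_scale scale) (Kt_set scale n l) (qt_form B n)) (dual scale \<times> {0})
      = dual scale \<times> K_set n l"
    using orthogonal_dual by (simp add: Kt_space_def)
  have P_sub: "dual scale \<times> K_set n l \<subseteq> Kt_set scale n l"
    by (auto simp: Kt_set_def K_set_def)
  interpret F: vector_space "\<lambda>c (a :: nat \<Rightarrow> 'v) i. scale c (a i)"
    by (rule vector_space_pointwise[OF vector_space_axioms])
  have "F.subspace (family_sum n l)" by (intro family_subspace l_subspace)
  then have K_subspace: "F.subspace (K_set n l)"
    by (auto simp: F.subspace_def K_set_def sum.distrib simp flip: scale_sum_right)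
  have P_subspace: "Kt.subspace (dual scale \<times> K_set n l)"
    by (rule dual_times_subspace[OF K_subspace])
  have P: "vectorspace class_ring ?P"
    by (rule vectorspace_space_on[OF vector_space_Kt P_subspace])
  have symP: "symmetric_bilinear_on ?P"
    unfolding symmetric_bilinear_on_def space_on_simps
    by (intro conjI ballI allI Kt.Q_sym Kt.Q_add_left Kt.Q_scale_left; erule subsetD[OF P_sub])
  have finP: "vectorspace.fin_dim class_ring ?P"
    by (rule Kt.space_on_dimension(1)[OF Kt.has_dimension_subspace(1)[OF has_dimension_Kt P_subspace P_sub]])

  have snd: "isometric_cover ?P ?K snd"
    unfolding isometric_cover_def
  proof (intro conjI)
    show "linear_map class_ring ?P ?K snd"
    proof (rule linear_mapI[OF P])
      show "vectorspace class_ring ?K"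
        unfolding K_space_def by (rule vectorspace_space_on[OF F.vector_space_axioms K_subspace])
    qed (auto simp: K_space_def Kt_scale_def)
    show "snd ` carrier ?P = carrier ?K"
      using dual_closed(1) by (auto simp: K_space_def image_iff)
    show "\<forall>x\<in>carrier ?P. \<forall>y\<in>carrier ?P. form ?K (snd x) (snd y) = form ?P x y"
      by (auto simp: K_space_def q_form_eq_qt_form)
  qed
  then interpret snd: linear_map class_ring ?P ?K snd by (simp add: isometric_cover_def)
  have symK: "symmetric_bilinear_on ?K" by (rule symmetric_bilinear_cover[OF snd symP])
  have finK: "vectorspace.fin_dim class_ring ?K"
    using snd.rank_nullity_main(2)[OF finP] snd by (simp add: isometric_cover_def)
  have \<kappa>: "isometric_cover ?K ?T ?\<kappa>" and T: "quadratic_space ?T"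
    unfolding T_space_def
    by (rule quadratic_space_quotient_kernel[OF snd.W.vectorspace_axioms symK finK])+
  show "quadratic_space ?T" by (rule T)
  have PT: "isometric_cover ?P ?T (\<lambda>x. ?\<kappa> (snd x))"
    by (rule isometric_cover_comp[OF snd \<kappa>])
  have kerT: "form_kernel ?T = {\<zero>\<^bsub>?T\<^esub>}" and kerTt: "form_kernel ?Tt = {\<zero>\<^bsub>?Tt\<^esub>}"
    and VT: "vectorspace class_ring ?T" and VTt: "vectorspace class_ring ?Tt"
    and symT: "symmetric_bilinear_on ?T" and symTt: "symmetric_bilinear_on ?Tt"
    using T Tt by (auto simp: quadratic_space_def)

  note iso = isotropic_dual[unfolded Kt_space_def]
  obtain m e f where pairs: "Kt.hyperbolic_pairs m (dual scale \<times> {0}) e f"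
    using hyperbolic_pairs_exist[OF Kt_symmetric_form two_neq_zero[OF char] has_dimension_dual_times_zero iso]
    by blast
  note hyp = Kt.hyperbolic_cover[OF iso pairs, unfolded P_eq]

  have "isometric (orthogonal_sum ?T (hyperbolic_space m)) ?Tt"
  proof -
    obtain F where F: "isometric_cover (orthogonal_sum ?P (hyperbolic_space m)) ?M F"
      using hyp(1) by (auto simp: Kt_space_def)
    have g: "isometric_cover (orthogonal_sum ?P (hyperbolic_space m))
        (orthogonal_sum ?T (hyperbolic_space m)) (map_prod (\<lambda>x. ?\<kappa> (snd x)) (\<lambda>x. x))"
      by (rule isometric_cover_sum[OF PT isometric_cover_id[OF vectorspace_hyperbolic]])
    show ?thesis
    proof (rule isometric_of_nondegenerate_covers[OF g isometric_cover_comp[OF F \<pi>]])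
      show "symmetric_bilinear_on (orthogonal_sum ?P (hyperbolic_space m))"
        by (rule symmetric_bilinear_orthogonal_sum[OF symP symmetric_bilinear_hyperbolic])
      show "form_kernel (orthogonal_sum ?T (hyperbolic_space m))
          = {\<zero>\<^bsub>orthogonal_sum ?T (hyperbolic_space m)\<^esub>}"
        unfolding form_kernel_orthogonal_sum[OF VT vectorspace_hyperbolic symT symmetric_bilinear_hyperbolic]
          kerT hyperbolic_nondegenerate
        by simp
    qed (rule kerTt)
  qed
  from isometric_trans[OF this isometric_sum_hyperbolic_0[OF VTt]]
  show "witt_equivalent ?T ?Tt"
    unfolding witt_equivalent_def by blast

  have I_eq: "?I = ?\<pi> ` (dual scale \<times> {0})"
    by (auto simp: dual_image_def)
  have formTt: "form ?Tt (?\<pi> x) (?\<pi> y) = qt_form B n x y"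
    if "x \<in> Kt_set scale n l" "y \<in> Kt_set scale n l" for x y
    using \<pi> that by (simp add: isometric_cover_def Kt_space_def)
  have carrierTt: "carrier ?Tt = ?\<pi> ` Kt_set scale n l"
    using \<pi> by (simp add: isometric_cover_def Kt_space_def)
  have D_sub: "dual scale \<times> {0} \<subseteq> dual scale \<times> K_set n l"
    using F.subspace_0[OF K_subspace] by auto
  have orthI: "orthogonal ?Tt ?I = ?\<pi> ` (dual scale \<times> K_set n l)"
  proof -
    have "orthogonal ?Tt ?I = ?\<pi> ` {x \<in> Kt_set scale n l. \<forall>y\<in>dual scale \<times> {0}. qt_form B n x y = 0}"
      using D_sub P_sub formTt unfolding orthogonal_def carrierTt I_eq by (auto simp: subset_iff)
    then show ?thesis using P_eq by (simp add: orthogonal_def)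
  qed
  have lin: "linear_map class_ring ?M ?Tt ?\<pi>" using \<pi> by (simp add: isometric_cover_def)
  let ?TI = "?Tt\<lparr>carrier := orthogonal ?Tt ?I\<rparr>"
  have I_carrier: "?I \<subseteq> carrier ?Tt"
    unfolding I_eq carrierTt using D_sub P_sub by blast
  have VTI: "vectorspace class_ring ?TI"
    using vectorspace.subspace_is_vs[OF VTt orthogonal_is_subspace[OF VTt symTt I_carrier]] .
  have \<pi>TI: "isometric_cover ?P ?TI ?\<pi>"
    unfolding isometric_cover_def
  proof (intro conjI ballI)
    show "linear_map class_ring ?P ?TI ?\<pi>"
    proof (rule linear_mapI[OF P VTI])
      fix x y c assume x: "x \<in> carrier ?P"
      then have xM: "x \<in> carrier ?M" using P_sub by (auto simp: Kt_space_def)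
      show "?\<pi> x \<in> carrier ?TI" using x orthI by auto
      show "?\<pi> (c \<odot>\<^bsub>?P\<^esub> x) = c \<odot>\<^bsub>?TI\<^esub> ?\<pi> x"
        using linear_mapD(5)[OF lin xM, of c] by (simp add: Kt_space_def)
      assume "y \<in> carrier ?P"
      then have "y \<in> carrier ?M" using P_sub by (auto simp: Kt_space_def)
      then show "?\<pi> (x \<oplus>\<^bsub>?P\<^esub> y) = ?\<pi> x \<oplus>\<^bsub>?TI\<^esub> ?\<pi> y"
        using linear_mapD(4)[OF lin xM, of y] by (simp add: Kt_space_def)
    qed
    show "?\<pi> ` carrier ?P = carrier ?TI" using orthI by simp
    show "form ?TI (?\<pi> x) (?\<pi> y) = form ?P x y" if "x \<in> carrier ?P" "y \<in> carrier ?P" for x y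
      using that P_sub formTt[of x y] by auto
  qed
  have symTI: "symmetric_bilinear_on ?TI" by (rule symmetric_bilinear_cover[OF \<pi>TI symP])
  have D_closed: "Kt.subspace (dual scale \<times> {0})"
    by (rule Kt.has_dimensionD(1)[OF has_dimension_dual_times_zero])
  have I_iso: "form ?Tt x y = 0" if "x \<in> ?I" "y \<in> ?I" for x y
  proof -
    obtain x' y' where "x' \<in> dual scale \<times> {0}" "x = ?\<pi> x'" "y' \<in> dual scale \<times> {0}" "y = ?\<pi> y'"
      using \<open>x \<in> ?I\<close> \<open>y \<in> ?I\<close> unfolding I_eq by blast
    then show ?thesis
      using iso formTt[of x' y'] D_sub P_sub by (auto simp: isotropic_subspace_def subset_iff)
  qed
  \<comment> \<open>Stated for any \<open>N\<close> with the operations of \<open>?Tt\<close>, since \<open>?I\<close> is needed as a subspace of \<open>?Tt\<close> and of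
    the orthogonal complement of \<open>?I\<close> in it.\<close>
  have I_submodule: "VectorSpace.subspace class_ring ?I N"
    if N: "vectorspace class_ring N" "?I \<subseteq> carrier N" "add N = add ?Tt" "zero N = zero ?Tt"
      "module.smult N = module.smult ?Tt" for N :: "('f, (('v \<Rightarrow> 'f) \<times> (nat \<Rightarrow> 'v)) set) form_space"
  proof -
    have DM: "x \<in> carrier ?M" if "x \<in> dual scale \<times> {0}" for x
      using that D_sub P_sub by (auto simp: Kt_space_def)
    have "Module.module class_ring N" using N(1) by (simp add: vectorspace_def)
    moreover have "?\<pi> x \<oplus>\<^bsub>?Tt\<^esub> ?\<pi> y \<in> ?I" if "x \<in> dual scale \<times> {0}" "y \<in> dual scale \<times> {0}" for x y
      unfolding I_eq linear_mapD(4)[OF lin DM DM, OF that, symmetric]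
      using Kt.subspace_add[OF D_closed that] by (intro imageI) (simp add: Kt_space_def)
    moreover have "c \<odot>\<^bsub>?Tt\<^esub> ?\<pi> x \<in> ?I" if "x \<in> dual scale \<times> {0}" for x c
      unfolding I_eq linear_mapD(5)[OF lin DM, OF that, symmetric]
      using Kt.subspace_scale[OF D_closed that] by (intro imageI) (simp add: Kt_space_def)
    moreover have "\<zero>\<^bsub>?Tt\<^esub> \<in> ?I"
      unfolding I_eq linear_mapD(6)[OF lin, symmetric]
      using Kt.subspace_0[OF D_closed] by (intro imageI) (simp add: Kt_space_def)
    ultimately have "submodule class_ring ?I N"
      using N(2-5) unfolding submodule_def by (auto simp: I_eq)
    then show ?thesis using N(1) by (simp add: VectorSpace.subspace_def)
  qed
  show "isotropic_subspace ?Tt ?I"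
    using I_submodule[OF VTt I_carrier] I_iso by (simp add: isotropic_subspace_def)

  have I_TI: "?I \<subseteq> carrier ?TI"
    using I_carrier I_iso by (auto simp: orthogonal_def)
  have sub_TI: "VectorSpace.subspace class_ring ?I ?TI"
    by (rule I_submodule[OF VTI I_TI]) simp_all
  have "form ?TI x y = 0" if "x \<in> ?I" "y \<in> carrier ?TI" for x y
  proof -
    have "form ?TI x y = form ?TI y x"
      using symTI that I_TI unfolding symmetric_bilinear_on_def by blast
    then show ?thesis using that by (simp add: orthogonal_def)
  qed
  then have I_ker: "?I \<subseteq> form_kernel ?TI"
    using I_TI unfolding orthogonal_def by blast
  let ?R = "quadratic_subquotient ?Tt ?I"
  let ?\<rho> = "\<lambda>x. ?I +>\<^bsub>?TI\<^esub> x"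
  have \<rho>: "isometric_cover ?TI ?R ?\<rho>"
    unfolding quadratic_subquotient_def by (rule quotient_cover[OF VTI sub_TI symTI I_ker])
  have PR: "isometric_cover ?P ?R (\<lambda>x. ?\<rho> (?\<pi> x))"
    by (rule isometric_cover_comp[OF \<pi>TI \<rho>])
  have "quadratic_space ?R"
  proof (rule quadratic_space_of_cover[OF PR symP finP])
    \<comment> \<open>A vector in the kernel of the form on \<open>P\<close> differs from a functional by a vector in the kernel of
      the form on the whole space, so its coset lies in \<open>?I\<close>.\<close>
    fix w assume w: "w \<in> form_kernel ?P"
    obtain v where v: "v \<in> dual scale \<times> {0}" "w - v \<in> form_kernel ?M"
      using hyp(2)[OF w] by (auto simp: Kt_space_def)
    note facts = coset_facts[OF V orthogonal_is_subspace[OF V sym order.refl]]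
    have "w = (w - v) \<oplus>\<^bsub>?M\<^esub> v" by (simp add: Kt_space_def)
    then have "w \<in> form_kernel ?M +>\<^bsub>?M\<^esub> v"
      using v(2) unfolding a_r_coset_def' by blast
    then have "?\<pi> w = ?\<pi> v"
      using facts(2)[of v w] v(1) D_sub P_sub by (auto simp: Kt_space_def)
    then have "?\<pi> w \<in> ?I" using v(1) I_eq by blast
    then have "?\<rho> (?\<pi> w) = ?I" by (rule coset_facts(4)[OF VTI sub_TI])
    then show "?\<rho> (?\<pi> w) = \<zero>\<^bsub>?R\<^esub>" by (simp add: quadratic_subquotient_def)
  qed
  then have "form_kernel ?R = {\<zero>\<^bsub>?R\<^esub>}" by (simp add: quadratic_space_def)
  then show "isometric ?T ?R"
    by (rule isometric_of_nondegenerate_covers[OF PT PR symP kerT])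
qed

end

theorem proposition10:
  fixes \<tau> :: "'f::field topology"
    and scl :: "'f \<Rightarrow> 'v::ab_group_add \<Rightarrow> 'v"
    and B :: "'v \<Rightarrow> 'v \<Rightarrow> 'f"
    and n :: nat
    and l :: "nat \<Rightarrow> 'v set"
  assumes "local_field \<tau>"
    and "CHAR('f) \<noteq> 2"
    and "\<exists>basis. finite_dimensional_vector_space scl basis"
    and "symplectic_form scl B"
    and "n \<ge> 2"
    and "\<forall>i\<in>{1..n}. lagrangian scl B (l i)"
  shows
    "(form_kernel (Kt_space scl B n l) = boundary_tilde B n ` edge_sum n l \<and>
      inj_on (boundary_tilde B n) (edge_sum n l) \<and>
      real (vectorspace.dim class_ring (Tt_space scl B n l)) =
        (real n + 2) * (real (vector_space.dim scl UNIV) / 2)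
        - (\<Sum>i=1..n. real (vector_space.dim scl (l i \<inter> l (cyc_succ n i))))) \<and>
     (quadratic_space (T_space scl B n l) \<and>
      quadratic_space (Tt_space scl B n l) \<and>
      isotropic_subspace (Tt_space scl B n l) (dual_image scl B n l) \<and>
      isometric (T_space scl B n l)
        (quadratic_subquotient (Tt_space scl B n l) (dual_image scl B n l)) \<and>
      witt_class (T_space scl B n l) \<in> carrier witt_group \<and>
      witt_class (T_space scl B n l) = witt_class (Tt_space scl B n l))"
proof -
  obtain basis where "finite_dimensional_vector_space scl basis" using assms(3) by blast
  then interpret finite_dimensional_vector_space scl basis .
  interpret lagrangian_cycle scl basis B n l
    by unfold_locales (use assms in auto)
  show ?thesis
    using form_kernel_Kt boundary_tilde_inj dim_Tt T_subquotient_of_Tt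
      witt_class_in_witt_group[OF T_subquotient_of_Tt(1)] witt_class_eqI[OF T_subquotient_of_Tt(1,2,5)]
    by blast
qed

end
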